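(* Let $T$ be a rank-one (cutting-and-stacking) transformation with height sets $(H_n)_{n\ge 0}$, let $r_n=|H_n|$, and let $k\ge 1$ be an integer. If $$\prod_{n=0}^\infty\left(1-\frac{1}{r_n^{k-1}}\right)=0,$$ then for every integer $\ell$ the $k$-fold cartesian product transformation $(T^\ell)^{(k)}=T^\ell\times\cdots\times T^\ell$ ($k$ factors) is conservative.
   Context: A column is an ordered finite collection of pairwise disjoint intervals in $\mathbb R$ of equal length (its levels), thought of as stacked, with heights indexed from $0$; its column map $T_C$ sends each point of a level other than the top one to the point directly above it in the next level. A rank-one (cutting-and-stacking) transformation $T$ is given by columns $C_0,C_1,C_2,\dots$ as follows: $C_0$ is the single level consisting of the unit interval; $C_{n+1}$ is obtained from $C_n$ by cutting $C_n$ into $r_n\ge 2$ subcolumns of equal width, numbered $0,\dots,r_n-1$ from left to right, adding $s_{n,k}\ge 0$ new levels (spacers: intervals of the same length as the subcolumn levels, disjoint from $C_n$ and from each other) above the $k$-th subcolumn, and stacking each subcolumn (with its spacers) under the subcolumn to its right. $X$ is the union of all levels of all columns, $\mu$ is Lebesgue measure on $X$, and $T$ is the pointwise limit of the $T_{C_n}$; it is an invertible (mod null sets) measure-preserving transformation. It is assumed that $\mu(X)=\infty$. Let $h_n$ be the number of levels of $C_n$. The $n$-th height set is $$H_n=\{0\}\cup\Big\{\sum_{k=0}^{\ell}(h_n+s_{n,k}) : 0\le \ell<r_n-1\Big\},$$ so $|H_n|=r_n$. A measure-preserving transformation $R$ of a measure space $(Y,\nu)$ is conservative if for every measurable $A$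 with $\nu(A)>0$ there is an integer $n\ge1$ with $\nu(A\cap R^{-n}A)>0$. *)

theory Defs
  imports "HOL-Analysis.Analysis"
begin

text \<open>Levels are half-open intervals, so that cutting a level really partitions it. A column is
  given by the common length of its levels and the list of their left endpoints, bottom to top.\<close>

datatype column = Column (col_width: real) (col_bases: "real list")

definition col_height :: "column \<Rightarrow> nat" where
  "col_height C = length (col_bases C)"

definition col_level :: "column \<Rightarrow> nat \<Rightarrow> real set" where
  "col_level C i = {col_bases C ! i ..< col_bases C ! i + col_width C}"

definition col_union :: "column \<Rightarrow> real set" where
  "col_union C = (\<Union>i<col_height C. col_level C i)"

text \<open>Outside its domain, the union of the levels below the top, the column map is set to be the
  identity. This does not affect the limit below: at every point of the union of all the columns,
  the column maps are eventually genuinely defined and constant along the sequence.\<close>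

definition col_map :: "column \<Rightarrow> real \<Rightarrow> real" where
  "col_map C x =
     (if \<exists>i. Suc i < col_height C \<and> x \<in> col_level C i
      then let i = (THE i. Suc i < col_height C \<and> x \<in> col_level C i)
           in col_bases C ! Suc i + (x - col_bases C ! i)
      else x)"

text \<open>Cutting into \<open>r\<close> subcolumns and putting \<open>s k\<close> spacers above the \<open>k\<close>-th one; \<open>p k j\<close> is the
  left endpoint of the \<open>j\<close>-th spacer from below above subcolumn \<open>k\<close>.\<close>

definition cut_and_stack ::
    "column \<Rightarrow> nat \<Rightarrow> (nat \<Rightarrow> nat) \<Rightarrow> (nat \<Rightarrow> nat \<Rightarrow> real) \<Rightarrow> column" where
  "cut_and_stack C r s p =
     Column (col_width C / real r)
       (concat (map (\<lambda>k. map (\<lambda>a. a + real k * (col_width C / real r)) (col_bases C)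
                         @ map (p k) [0..<s k]) [0..<r]))"

primrec rank_one_column ::
    "(nat \<Rightarrow> nat) \<Rightarrow> (nat \<Rightarrow> nat \<Rightarrow> nat) \<Rightarrow> (nat \<Rightarrow> nat \<Rightarrow> nat \<Rightarrow> real) \<Rightarrow> nat \<Rightarrow> column" where
  "rank_one_column r s p 0 = Column 1 [0]"
| "rank_one_column r s p (Suc n) = cut_and_stack (rank_one_column r s p n) (r n) (s n) (p n)"

definition spacer ::
    "(nat \<Rightarrow> nat) \<Rightarrow> (nat \<Rightarrow> nat \<Rightarrow> nat) \<Rightarrow> (nat \<Rightarrow> nat \<Rightarrow> nat \<Rightarrow> real) \<Rightarrow> nat \<Rightarrow> nat \<times> nat \<Rightarrow> real set" where
  "spacer r s p n = (\<lambda>(k, j). {p n k j ..< p n k j + col_width (rank_one_column r s p (Suc n))})"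

definition rank_one_data ::
    "(nat \<Rightarrow> nat) \<Rightarrow> (nat \<Rightarrow> nat \<Rightarrow> nat) \<Rightarrow> (nat \<Rightarrow> nat \<Rightarrow> nat \<Rightarrow> real) \<Rightarrow> bool" where
  "rank_one_data r s p \<longleftrightarrow>
     (\<forall>n. r n \<ge> 2 \<and>
          disjoint_family_on (spacer r s p n) (SIGMA k:{..<r n}. {..<s n k}) \<and>
          (\<forall>q \<in> (SIGMA k:{..<r n}. {..<s n k}).
             spacer r s p n q \<inter> col_union (rank_one_column r s p n) = {}))"

definition rank_one_space ::
    "(nat \<Rightarrow> nat) \<Rightarrow> (nat \<Rightarrow> nat \<Rightarrow> nat) \<Rightarrow> (nat \<Rightarrow> nat \<Rightarrow> nat \<Rightarrow> real) \<Rightarrow> real set" where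
  "rank_one_space r s p = (\<Union>n. col_union (rank_one_column r s p n))"

definition rank_one_measure ::
    "(nat \<Rightarrow> nat) \<Rightarrow> (nat \<Rightarrow> nat \<Rightarrow> nat) \<Rightarrow> (nat \<Rightarrow> nat \<Rightarrow> nat \<Rightarrow> real) \<Rightarrow> real measure" where
  "rank_one_measure r s p = restrict_space lebesgue (rank_one_space r s p)"

definition rank_one_map ::
    "(nat \<Rightarrow> nat) \<Rightarrow> (nat \<Rightarrow> nat \<Rightarrow> nat) \<Rightarrow> (nat \<Rightarrow> nat \<Rightarrow> nat \<Rightarrow> real) \<Rightarrow> real \<Rightarrow> real" where
  "rank_one_map r s p x = lim (\<lambda>n. col_map (rank_one_column r s p n) x)"

definition height_set ::
    "(nat \<Rightarrow> nat) \<Rightarrow> (nat \<Rightarrow> nat \<Rightarrow> nat) \<Rightarrow> (nat \<Rightarrow> nat \<Rightarrow> nat \<Rightarrow> real) \<Rightarrow> nat \<Rightarrow> nat set" where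
  "height_set r s p n =
     {0} \<union> {\<Sum>k=0..l. col_height (rank_one_column r s p n) + s n k | l. l < r n - 1}"

text \<open>Integer powers of a map that is injective on \<open>X\<close> and onto \<open>X\<close> up to a null set. On the null
  set of points without preimage (for a rank-one map only the point 0, the common
  left endpoint of the bottom levels) the inverse is set to be the identity.\<close>

definition inverse_map :: "'a set \<Rightarrow> ('a \<Rightarrow> 'a) \<Rightarrow> 'a \<Rightarrow> 'a" where
  "inverse_map X T x = (if x \<in> T ` X then inv_into X T x else x)"

definition int_power :: "'a set \<Rightarrow> ('a \<Rightarrow> 'a) \<Rightarrow> int \<Rightarrow> 'a \<Rightarrow> 'a" where
  "int_power X T l = (if l \<ge> 0 then T ^^ nat l else inverse_map X T ^^ nat (- l))"

definition product_map :: "nat \<Rightarrow> ('a \<Rightarrow> 'a) \<Rightarrow> (nat \<Rightarrow> 'a) \<Rightarrow> nat \<Rightarrow> 'a" where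
  "product_map k R x = (\<lambda>i\<in>{..<k}. R (x i))"

definition measure_preserving :: "'a measure \<Rightarrow> ('a \<Rightarrow> 'a) \<Rightarrow> bool" where
  "measure_preserving M R \<longleftrightarrow>
     R \<in> measurable M M \<and>
     (\<forall>A \<in> sets M. emeasure M (R -` A \<inter> space M) = emeasure M A)"

definition conservative :: "'a measure \<Rightarrow> ('a \<Rightarrow> 'a) \<Rightarrow> bool" where
  "conservative M R \<longleftrightarrow>
     measure_preserving M R \<and>
     (\<forall>A \<in> sets M. emeasure M A > 0 \<longrightarrow>
        (\<exists>n\<ge>1. emeasure M (A \<inter> ((R ^^ n) -` A \<inter> space M)) > 0))"

lemma col_height_pos:
  assumes "rank_one_data r s p"
  shows "col_height (rank_one_column r s p n) > 0"
proof (induction n)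
  case 0
  show ?case by (simp add: col_height_def)
next
  case (Suc n)
  have "r n \<ge> 2" using assms by (simp add: rank_one_data_def)
  then have "0 \<in> set [0..<r n]" by simp
  with Suc show ?case by (fastforce simp: col_height_def cut_and_stack_def)
qed

lemma card_height_set:
  assumes "rank_one_data r s p"
  shows "card (height_set r s p n) = r n"
proof -
  define h where "h = col_height (rank_one_column r s p n)"
  define f where "f l = (\<Sum>k=0..l. h + s n k)" for l
  have h: "h > 0" using col_height_pos[OF assms] by (simp add: h_def)
  have r: "r n \<ge> 2" using assms by (simp add: rank_one_data_def)
  have mono: "strict_mono f"
    by (rule strict_monoI_Suc) (use h in \<open>simp add: f_def\<close>)
  have pos: "f l > 0" for l
    using h by (auto simp: f_def intro!: sum_pos)
  have eq: "height_set r s p n = insert 0 (f ` {..<r n - 1})"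
    by (auto simp: height_set_def f_def h_def)
  have "card (f ` {..<r n - 1}) = r n - 1"
    using strict_mono_imp_inj_on[OF mono] by (subst card_image) (auto intro: inj_on_subset)
  moreover have "0 \<notin> f ` {..<r n - 1}" using pos by (metis image_iff less_irrefl)
  ultimately show ?thesis using r by (simp add: eq)
qed

end

theory Submission
  imports Defs
begin

text \<open>
  Let \<open>S\<close> be the \<open>k\<close>-fold product of \<open>T\<close>. Conservativity of \<open>S\<close> passes to its powers by pigeonhole on
  simultaneous return times, and to the inverse, so only a measurable set \<open>A\<close> with
  \<open>A \<inter> S\<^sup>-\<^sup>m A = {}\<close> for all \<open>m \<ge> 1\<close> has to be shown null. Cut a product \<open>B\<close> of \<open>k\<close> levels of the \<open>n\<close>-th
  column into the \<open>r\<^sub>n\<^sup>k\<close> products of sublevels. The \<open>r\<^sub>n\<close> diagonal ones, where all coordinates lie in the same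
  subcolumn, are images of one another under powers of \<open>S\<close>, so \<open>A\<close> fills at most the fraction
  \<open>1 / r\<^sub>n \<le> 1 / 2\<close> of their union. Iterating on the off-diagonal ones, \<open>A\<close> fills at most
  \<open>1 / 2 + 1 / 2 \<Prod>\<^sub>m (1 - 1 / r\<^sub>m\<^sup>k\<^sup>-\<^sup>1)\<close> of \<open>B\<close>, hence at most half of it. As finite unions of such
  products approximate every measurable set, \<open>A\<close> is null.
\<close>

section \<open>Conservative maps\<close>

text \<open>Off-diagonal subboxes admit no direct argument: their coordinates lie in different
  subcolumns, so no power of \<open>S\<close> need carry one to another. Each is again a box of the
  next column, though. They make up r^k - r of the r^k subboxes, the share 1 - 1/r^(k-1) of the
  hypothesis. With t = 1/r^(k-1), a density bound c valid for boxes of the next column becomes t/2 +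
  (1 - t) c. This affine map fixes 1/2 and multiplies the excess c - 1/2 by 1 - t, so the excess
  dies with the product. Any uniform density bound below 1 would do; 1/2 is what r >= 2 yields.
  Three technical points shape the rest. The product space has infinite measure, so approximation
  takes place inside the finite-measure sets \<open>stage N\<close>. Measurable sets are Lebesgue
  rather than Borel, so null sets have to be approximated as well. The point 0 has no preimage under
  \<open>T\<close>, so \<open>inverse_map\<close> is used only as a left inverse.\<close>

lemma measure_preserving_emeasure:
  assumes "measure_preserving M R" "A \<in> sets M"
  shows "emeasure M (R -` A \<inter> space M) = emeasure M A"
  using assms unfolding measure_preserving_def by blast

lemma measure_preserving_comp:
  assumes "measure_preserving M R" "measure_preserving M Q"
  shows "measure_preserving M (R \<circ> Q)"
  unfolding measure_preserving_def
proof (intro conjI ballI)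
  have R: "R \<in> measurable M M" and Q: "Q \<in> measurable M M"
    using assms by (auto simp: measure_preserving_def)
  then show "R \<circ> Q \<in> measurable M M" by (rule measurable_comp[rotated])
  fix A assume A: "A \<in> sets M"
  have "(R \<circ> Q) -` A \<inter> space M = Q -` (R -` A \<inter> space M) \<inter> space M"
    using measurable_space[OF Q] by auto
  then show "emeasure M ((R \<circ> Q) -` A \<inter> space M) = emeasure M A"
    using measure_preserving_emeasure[OF assms(2) measurable_sets[OF R A]]
      measure_preserving_emeasure[OF assms(1) A] by presburger
qed

lemma measure_preserving_funpow:
  assumes "measure_preserving M R"
  shows "measure_preserving M (R ^^ n)"
proof (induction n)
  case 0
  show ?case by (auto simp: measure_preserving_def sets.Int_space_eq2)
next
  case (Suc n)
  show ?case using measure_preserving_comp[OF assms Suc] by (simp only: funpow.simps)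
qed

lemma measure_preserving_funpow_space:
  assumes "measure_preserving M R" "x \<in> space M"
  shows "(R ^^ n) x \<in> space M"
  using measure_preserving_funpow[OF assms(1), of n] assms(2)
  by (auto simp: measure_preserving_def dest: measurable_space)

lemma measure_preserving_funpow_sets:
  assumes "measure_preserving M R" "A \<in> sets M"
  shows "(R ^^ n) -` A \<inter> space M \<in> sets M"
  using measure_preserving_funpow[OF assms(1), of n] assms(2)
  by (auto simp: measure_preserving_def dest: measurable_sets)

lemma measure_preserving_cong:
  assumes "\<And>x. x \<in> space M \<Longrightarrow> R x = Q x"
  shows "measure_preserving M R \<longleftrightarrow> measure_preserving M Q"
proof -
  have "R -` A \<inter> space M = Q -` A \<inter> space M" for A using assms by auto
  then show ?thesis using measurable_cong[of M R Q M] assms by (simp add: measure_preserving_def)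
qed

text \<open>Needed because powers of a product map and product maps of powers agree only on the
  product space, whose points are extensional functions.\<close>

lemma conservative_cong:
  assumes eq: "\<And>x. x \<in> space M \<Longrightarrow> R x = Q x"
    and R: "conservative M R"
  shows "conservative M Q"
proof -
  have mp: "measure_preserving M R" using R by (simp add: conservative_def)
  have "(R ^^ n) x = (Q ^^ n) x" if "x \<in> space M" for n x
  proof (induction n)
    case (Suc n)
    then show ?case using eq[OF measure_preserving_funpow_space[OF mp that, of n]] by simp
  qed simp
  then have "(R ^^ n) -` A \<inter> space M = (Q ^^ n) -` A \<inter> space M" for n A by auto
  then show ?thesis
    using R measure_preserving_cong[of M R Q] eq by (simp add: conservative_def)
qed

text \<open>Iterating the definition of conservativity yields arbitrarily large finite sets of
  simultaneous return times.\<close>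

lemma conservative_return_times:
  assumes R: "conservative M R" and A: "A \<in> sets M" "emeasure M A > 0"
  shows "\<exists>F. finite F \<and> card F > n \<and> {x \<in> space M. \<forall>t\<in>F. (R ^^ t) x \<in> A} \<in> sets M \<and>
    emeasure M {x \<in> space M. \<forall>t\<in>F. (R ^^ t) x \<in> A} > 0"
proof (induction n)
  case 0
  have "{x \<in> space M. x \<in> A} = A" using sets.sets_into_space[OF A(1)] by auto
  then show ?case using A by (intro exI[of _ "{0}"]) simp
next
  case (Suc n)
  have mp: "measure_preserving M R" using R by (simp add: conservative_def)
  define B where "B F = {x \<in> space M. \<forall>t\<in>F. (R ^^ t) x \<in> A}" for F
  from Suc obtain F where F: "finite F" "card F > n" "B F \<in> sets M" "emeasure M (B F) > 0"
    unfolding B_def by blast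
  from R F obtain m where m: "m \<ge> 1" "emeasure M (B F \<inter> ((R ^^ m) -` B F \<inter> space M)) > 0"
    unfolding conservative_def by blast
  \<comment> \<open>A point of \<open>B F\<close> that is in \<open>B F\<close> again after
    \<open>m\<close> steps visits \<open>A\<close> at all times in \<open>F\<close> and in
    \<open>F + m\<close>. The largest of these times is new, so the cardinality grows.\<close>
  define G where "G = F \<union> (\<lambda>t. t + m) ` F"
  have "(R ^^ (t + m)) x = (R ^^ t) ((R ^^ m) x)" for t x by (simp add: funpow_add)
  then have "B F \<inter> ((R ^^ m) -` B F \<inter> space M) = B G"
    using measure_preserving_funpow_space[OF mp, of _ m]
    by (auto simp: B_def G_def ball_Un)
  moreover have "B F \<inter> ((R ^^ m) -` B F \<inter> space M) \<in> sets M"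
    using F measure_preserving_funpow_sets[OF mp F(3), of m] by auto
  moreover have "card G > Suc n"
  proof -
    have "F \<noteq> {}" using F by auto
    then have "Max F + m \<in> G" using F by (auto simp: G_def)
    moreover have "Max F + m \<notin> F" using F m Max_ge[of F "Max F + m"] by auto
    ultimately have "F \<subset> G" by (auto simp: G_def)
    then have "card F < card G" using F by (intro psubset_card_mono) (auto simp: G_def)
    then show ?thesis using F by simp
  qed
  moreover have "finite G" using F by (simp add: G_def)
  ultimately have "finite G \<and> card G > Suc n \<and> B G \<in> sets M \<and> emeasure M (B G) > 0"
    using m by simp
  then show ?case unfolding B_def by (rule exI)
qed

lemma conservative_funpow:
  assumes R: "conservative M R"
  shows "conservative M (R ^^ l)"
  unfolding conservative_def
proof (intro conjI ballI impI)
  have mp: "measure_preserving M R" using R by (simp add: conservative_def)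
  then show "measure_preserving M (R ^^ l)" by (rule measure_preserving_funpow)
  fix A assume A: "A \<in> sets M" "emeasure M A > 0"
  show "\<exists>n\<ge>1. emeasure M (A \<inter> (((R ^^ l) ^^ n) -` A \<inter> space M)) > 0"
  \<comment> \<open>The zeroth power is the identity. It is treated apart since
    \<open>t mod 0 = t\<close>, which leaves no bound on the number of residues.\<close>
  proof (cases "l = 0")
    case True
    have "A \<inter> (A \<inter> space M) = A" using sets.sets_into_space[OF A(1)] by auto
    moreover have "(R ^^ l) ^^ 1 = (\<lambda>x. x)" using True by auto
    ultimately show ?thesis using A by (intro exI[of _ 1]) (auto simp: vimage_def)
  next
    case False
    obtain F where F: "finite F" "card F > l"
      and pos: "emeasure M {x \<in> space M. \<forall>t\<in>F. (R ^^ t) x \<in> A} > 0"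
      using conservative_return_times[OF R A, of l] by blast
    have "(\<lambda>t. t mod l) ` F \<subseteq> {..<l}" using False by auto
    then have "card ((\<lambda>t. t mod l) ` F) \<le> l"
      by (metis card_lessThan card_mono finite_lessThan)
    then have "\<not> inj_on (\<lambda>t. t mod l) F" using F by (intro pigeonhole) simp
    then obtain t u where tu: "t \<in> F" "u \<in> F" "t mod l = u mod l" "t < u"
      by (metis (no_types, lifting) inj_on_def nat_neq_iff)
    then have "l dvd u - t" using mod_eq_dvd_iff_nat[of t u l] by simp
    then obtain n where n: "u - t = l * n" by blast
    with tu have n1: "n \<ge> 1" by (cases n) auto
    have un: "u = l * n + t" using n tu by linarith
    \<comment> \<open>\<open>?B\<close> collects the returns to \<open>A\<close> after
      \<open>n\<close> steps of \<open>R ^^ l\<close>. Points visiting \<open>A\<close> at both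
      times \<open>t\<close> and \<open>u = l * n + t\<close> lie in its preimage under
      \<open>R ^^ t\<close>, which has the same measure.\<close>
    let ?B = "A \<inter> (((R ^^ l) ^^ n) -` A \<inter> space M)"
    have B: "?B \<in> sets M"
      using A(1) measure_preserving_funpow_sets[OF mp A(1), of "l * n"] by (simp add: funpow_mult)
    have "(R ^^ u) x = ((R ^^ l) ^^ n) ((R ^^ t) x)" for x
      by (simp add: un funpow_add funpow_mult)
    then have "{x \<in> space M. \<forall>t\<in>F. (R ^^ t) x \<in> A} \<subseteq> (R ^^ t) -` ?B \<inter> space M"
      using tu measure_preserving_funpow_space[OF mp] by (auto simp: comp_def)
    then have "emeasure M {x \<in> space M. \<forall>t\<in>F. (R ^^ t) x \<in> A} \<le> emeasure M ((R ^^ t) -` ?B \<inter> space M)"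
      using B by (intro emeasure_mono measure_preserving_funpow_sets[OF mp])
    also have "\<dots> = emeasure M ?B"
      by (rule measure_preserving_emeasure[OF measure_preserving_funpow[OF mp] B])
    finally show ?thesis using pos n1 by (intro exI[of _ n]) auto
  qed
qed

text \<open>Pulling back along \<open>R ^^ n\<close> undoes \<open>Q ^^ n\<close>. Hence it turns
  the points of \<open>A\<close> that return under \<open>Q ^^ n\<close> into those that return
  under \<open>R ^^ n\<close>, without changing the measure.\<close>

lemma conservative_left_inverse:
  assumes R: "conservative M R" and Q: "Q \<in> measurable M M"
    and inv: "\<And>x. x \<in> space M \<Longrightarrow> Q (R x) = x"
  shows "conservative M Q"
proof -
  have mp: "measure_preserving M R" using R by (simp add: conservative_def)
  have invn: "(Q ^^ n) ((R ^^ n) x) = x" if "x \<in> space M" for n x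
    using that
  proof (induction n)
    case (Suc n)
    have "(Q ^^ Suc n) ((R ^^ Suc n) x) = (Q ^^ n) (Q (R ((R ^^ n) x)))"
      by (simp add: funpow_swap1)
    then show ?case using Suc inv measure_preserving_funpow_space[OF mp] by simp
  qed simp
  have mpQ: "measure_preserving M Q"
    unfolding measure_preserving_def
  proof (intro conjI ballI Q)
    fix A assume A: "A \<in> sets M"
    have "R -` (Q -` A \<inter> space M) \<inter> space M = A"
      using inv sets.sets_into_space[OF A] mp by (auto simp: measure_preserving_def dest: measurable_space)
    then show "emeasure M (Q -` A \<inter> space M) = emeasure M A"
      using mp measurable_sets[OF Q A] by (metis measure_preserving_def)
  qed
  show ?thesis
    unfolding conservative_def
  proof (intro conjI ballI impI mpQ)
    fix A assume A: "A \<in> sets M" "emeasure M A > 0"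
    then obtain n where n: "n \<ge> 1" "emeasure M (A \<inter> ((R ^^ n) -` A \<inter> space M)) > 0"
      using R unfolding conservative_def by blast
    let ?B = "A \<inter> ((Q ^^ n) -` A \<inter> space M)"
    have "?B \<in> sets M" using A(1) measure_preserving_funpow_sets[OF mpQ A(1), of n] by simp
    then have "emeasure M ?B = emeasure M ((R ^^ n) -` ?B \<inter> space M)"
      by (rule measure_preserving_emeasure[OF measure_preserving_funpow[OF mp], symmetric])
    also have "(R ^^ n) -` ?B \<inter> space M = A \<inter> ((R ^^ n) -` A \<inter> space M)"
      using invn measure_preserving_funpow_space[OF mp] by auto
    finally show "\<exists>n\<ge>1. emeasure M (A \<inter> ((Q ^^ n) -` A \<inter> space M)) > 0" using n by auto
  qed
qed

text \<open>If all returns to \<open>A\<close> have measure zero, discarding the countable union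
  \<open>N\<close> of the returning points leaves a set of equal measure with no returns at all.
  Later arguments can then use exact disjointness.\<close>

lemma conservativeI_wandering:
  assumes mp: "measure_preserving M R"
    and null: "\<And>A. A \<in> sets M \<Longrightarrow> (\<And>n. n \<ge> 1 \<Longrightarrow> A \<inter> (R ^^ n) -` A = {}) \<Longrightarrow> emeasure M A = 0"
  shows "conservative M R"
  unfolding conservative_def
proof (intro conjI ballI impI mp, rule ccontr)
  fix A assume A: "A \<in> sets M" "emeasure M A > 0"
  assume "\<not> (\<exists>n\<ge>1. emeasure M (A \<inter> ((R ^^ n) -` A \<inter> space M)) > 0)"
  then have z: "emeasure M (A \<inter> ((R ^^ n) -` A \<inter> space M)) = 0" if "n \<ge> 1" for n
    using that by (auto simp: not_less)
  define N where "N = (\<Union>n\<in>{1..}. A \<inter> ((R ^^ n) -` A \<inter> space M))"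
  have s: "A \<inter> ((R ^^ n) -` A \<inter> space M) \<in> sets M" for n
    using A measure_preserving_funpow_sets[OF mp A(1), of n] by simp
  have N: "N \<in> null_sets M"
    unfolding N_def by (rule null_sets_UN') (use s z in auto)
  have "emeasure M (A - N) = 0"
  proof (rule null)
    show "A - N \<in> sets M" using A N by auto
    fix n :: nat assume "n \<ge> 1"
    then show "(A - N) \<inter> (R ^^ n) -` (A - N) = {}"
      using sets.sets_into_space[OF A(1)] by (auto simp: N_def)
  qed
  then show False using A emeasure_Diff_null_set[OF N A(1)] by simp
qed

section \<open>Cartesian powers of a map\<close>

text \<open>Extensionality matters for \<open>n = 0\<close>: the zeroth power leaves
  \<open>x\<close> alone, while \<open>product_map\<close> always resets the values outside
  \<open>{..<k}\<close>.\<close>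

lemma product_map_funpow:
  assumes "x \<in> extensional {..<k}"
  shows "(product_map k R ^^ n) x = product_map k (R ^^ n) x"
proof (induction n)
  case 0
  show ?case using assms by (auto simp: product_map_def fun_eq_iff extensional_def)
next
  case (Suc n)
  then show ?case by (auto simp: product_map_def fun_eq_iff)
qed

lemma measurable_product_map:
  assumes "R \<in> measurable M M"
  shows "product_map k R \<in> measurable (Pi\<^sub>M {..<k} (\<lambda>_. M)) (Pi\<^sub>M {..<k} (\<lambda>_. M))"
  unfolding product_map_def[abs_def] restrict_def
  by (rule measurable_PiM_single')
    (use assms in \<open>auto simp: space_PiM PiE_iff extensional_def dest: measurable_space\<close>)

text \<open>By uniqueness of the product measure it is enough that the image measure agrees with it
  on rectangles, where preimages are taken factor by factor.\<close>

lemma measure_preserving_product_map: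
  assumes sf: "sigma_finite_measure M" and R: "measure_preserving M R"
  shows "measure_preserving (Pi\<^sub>M {..<k} (\<lambda>_. M)) (product_map k R)"
proof -
  interpret product_sigma_finite "\<lambda>_. M" by (simp add: product_sigma_finite_def sf)
  let ?P = "Pi\<^sub>M {..<k} (\<lambda>_. M)"
  have Rm: "R \<in> measurable M M" using R by (simp add: measure_preserving_def)
  note m = measurable_product_map[OF Rm, of k]
  have "distr ?P ?P (product_map k R) = ?P"
  proof (rule PiM_eqI)
    fix A assume A: "\<And>i. i \<in> {..<k} \<Longrightarrow> A i \<in> sets M"
    have "product_map k R -` Pi\<^sub>E {..<k} A \<inter> space ?P = (\<Pi>\<^sub>E i\<in>{..<k}. R -` A i \<inter> space M)"
      by (auto simp: product_map_def space_PiM PiE_iff Pi_iff)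
    then have "emeasure (distr ?P ?P (product_map k R)) (Pi\<^sub>E {..<k} A)
        = emeasure ?P (\<Pi>\<^sub>E i\<in>{..<k}. R -` A i \<inter> space M)"
      using A m by (subst emeasure_distr) auto
    also have "\<dots> = (\<Prod>i<k. emeasure M (R -` A i \<inter> space M))"
      using A Rm by (intro emeasure_PiM) (auto intro: measurable_sets)
    also have "\<dots> = (\<Prod>i<k. emeasure M (A i))"
      using A R by (intro prod.cong) (auto simp: measure_preserving_def)
    finally show "emeasure (distr ?P ?P (product_map k R)) (Pi\<^sub>E {..<k} A) = (\<Prod>i<k. emeasure M (A i))" .
  qed auto
  then show ?thesis using m by (metis emeasure_distr measure_preserving_def)
qed

section \<open>Approximation by an algebra of sets\<close>

text \<open>Complementation does not change a symmetric difference, and errors add up under finite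
  unions. Finiteness of the measure enters through countable unions, which are approximated by
  finite ones.\<close>

lemma (in finite_measure) sigma_algebra_approx:
  assumes alg: "algebra (space M) \<A>" and sub: "\<A> \<subseteq> sets M"
  shows "sigma_algebra (space M)
    {E \<in> sets M. \<forall>e>0. \<exists>B\<in>\<A>. measure M (sym_diff E B) < e}"
    (is "sigma_algebra _ ?D")
proof -
  interpret \<A>: algebra "space M" \<A> by fact
  have un: "E \<union> F \<in> ?D" if E: "E \<in> ?D" and F: "F \<in> ?D" for E F
  proof (safe)
    show "E \<union> F \<in> sets M" using E F by auto
    fix e :: real assume "e > 0"
    then have "e / 2 > 0" by simp
    then obtain B C where BC: "B \<in> \<A>" "C \<in> \<A>"
      "measure M (sym_diff E B) < e / 2" "measure M (sym_diff F C) < e / 2"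
      using E F by blast
    have "measure M (sym_diff (E \<union> F) (B \<union> C)) \<le> measure M (sym_diff E B \<union> sym_diff F C)"
      using E F BC sub by (intro finite_measure_mono) auto
    also have "\<dots> \<le> measure M (sym_diff E B) + measure M (sym_diff F C)"
      using E F BC sub by (intro measure_subadditive) auto
    finally have "measure M (sym_diff (E \<union> F) (B \<union> C)) < e" using BC by simp
    then show "\<exists>B\<in>\<A>. measure M (sym_diff (E \<union> F) B) < e" using BC by blast
  qed
  have "algebra (space M) ?D"
    unfolding algebra_iff_Un
  proof (intro conjI ballI un)
    show "?D \<subseteq> Pow (space M)" using sets.sets_into_space by auto
    show "{} \<in> ?D" by (auto intro!: bexI[of _ "{}"])
    fix E assume E: "E \<in> ?D"
    show "space M - E \<in> ?D"
    proof safe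
      show "space M - E \<in> sets M" using E by auto
      fix e :: real assume "e > 0"
      then obtain B where B: "B \<in> \<A>" "measure M (sym_diff E B) < e" using E by blast
      have "sym_diff (space M - E) (space M - B) = sym_diff E B"
        using E B sub sets.sets_into_space by blast
      then show "\<exists>B\<in>\<A>. measure M (sym_diff (space M - E) B) < e"
        using B by (intro bexI[of _ "space M - B"]) auto
    qed
  qed auto
  moreover have "(\<Union>i::nat. E i) \<in> ?D" if E: "range E \<subseteq> ?D" for E
  proof safe
    have Es: "E i \<in> sets M" for i using E by auto
    then show U: "(\<Union>i. E i) \<in> sets M" by auto
    define G where "G n = (\<Union>i\<le>n. E i)" for n
    have G: "G n \<in> ?D" for n
    proof (induction n)
      case 0
      show ?case using E by (auto simp: G_def)
    next
      case (Suc n)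
      have "G (Suc n) = G n \<union> E (Suc n)" by (auto simp: G_def le_Suc_eq)
      moreover have "G n \<union> E (Suc n) \<in> ?D" by (rule un[OF Suc]) (use E in auto)
      ultimately show ?case by (simp only:)
    qed
    have "incseq G" by (auto simp: G_def incseq_def intro: order_trans)
    moreover have UG: "(\<Union>i. G i) = (\<Union>i. E i)" by (auto simp: G_def)
    ultimately have "(\<lambda>n. measure M (G n)) \<longlonglongrightarrow> measure M (\<Union>i. E i)"
      using finite_Lim_measure_incseq[of G] G by auto
    moreover fix e :: real assume e: "e > 0"
    ultimately have "eventually (\<lambda>n. measure M (G n) > measure M (\<Union>i. E i) - e / 2) sequentially"
      by (intro order_tendstoD) auto
    then obtain n where n: "measure M (G n) > measure M (\<Union>i. E i) - e / 2"
      by (auto simp: eventually_sequentially)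
    have Gs: "G n \<in> sets M" using G by auto
    have "measure M ((\<Union>i. E i) - G n) = measure M (\<Union>i. E i) - measure M (G n)"
      by (rule finite_measure_Diff) (use Gs U UG in auto)
    then have 1: "measure M ((\<Union>i. E i) - G n) < e / 2" using n by simp
    obtain B where B: "B \<in> \<A>" "measure M (sym_diff (G n) B) < e / 2" 
      using G[of n] half_gt_zero[OF e] by blast
    have "measure M (sym_diff (\<Union>i. E i) B) \<le> measure M (((\<Union>i. E i) - G n) \<union> sym_diff (G n) B)"
      using U Gs B sub UG by (intro finite_measure_mono) auto
    also have "\<dots> \<le> measure M ((\<Union>i. E i) - G n) + measure M (sym_diff (G n) B)"
      using U Gs B sub by (intro measure_subadditive) auto
    finally have "measure M (sym_diff (\<Union>i. E i) B) < e" using 1 B by simp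
    then show "\<exists>B\<in>\<A>. measure M (sym_diff (\<Union>i. E i) B) < e" using B by blast
  qed
  ultimately show ?thesis by (simp add: sigma_algebra_iff)
qed

section \<open>Levels of a rank-one construction\<close>

text \<open>With one block per subcolumn, this reads off the left endpoint of any level of the next
  column from the concatenated list.\<close>

lemma nth_concat_map_upt:
  assumes "a < m" "i < length (f a)"
  shows "concat (map f [0..<m]) ! ((\<Sum>j<a. length (f j)) + i) = f a ! i"
  using assms(1)
proof (induction m)
  case (Suc m)
  have len: "length (concat (map f [0..<m])) = (\<Sum>j<m. length (f j))" for m
    by (induction m) auto
  show ?case
  proof (cases "a = m")
    case True
    then show ?thesis by (simp add: nth_append len)
  next
    case False
    then have "a < m" using Suc.prems by simp
    have "(\<Sum>j<a. length (f j)) + i < (\<Sum>j<Suc a. length (f j))" using assms(2) by simp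
    also have "\<dots> \<le> (\<Sum>j<m. length (f j))" using \<open>a < m\<close> by (intro sum_mono2) auto
    finally show ?thesis using Suc.IH[OF \<open>a < m\<close>] by (simp add: nth_append len)
  qed
qed simp

lemma sum_lessThan_decompose:
  fixes f :: "nat \<Rightarrow> nat"
  assumes "i < (\<Sum>j<m. f j)"
  shows "\<exists>a<m. \<exists>q<f a. i = (\<Sum>j<a. f j) + q"
  using assms
proof (induction m)
  case (Suc m)
  show ?case
  proof (cases "i < (\<Sum>j<m. f j)")
    case True
    then show ?thesis using Suc.IH by (metis less_SucI)
  next
    case False
    then show ?thesis
      using Suc.prems by (intro exI[of _ m] conjI exI[of _ "i - (\<Sum>j<m. f j)"]) auto
  qed
qed simp

declare rank_one_column.simps(2) [simp del]

locale rank_one =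
  fixes r :: "nat \<Rightarrow> nat" and s :: "nat \<Rightarrow> nat \<Rightarrow> nat" and p :: "nat \<Rightarrow> nat \<Rightarrow> nat \<Rightarrow> real"
  assumes data: "rank_one_data r s p"
begin

abbreviation "col n \<equiv> rank_one_column r s p n"
abbreviation "width n \<equiv> col_width (col n)"
abbreviation "base n i \<equiv> col_bases (col n) ! i"
abbreviation "height n \<equiv> col_height (col n)"
abbreviation "level n i \<equiv> col_level (col n) i"
abbreviation "X \<equiv> rank_one_space r s p"
abbreviation "T \<equiv> rank_one_map r s p"

text \<open>The height at which subcolumn \<open>a\<close> starts inside the next column. For
  \<open>a < r n\<close> these numbers are the elements of the height set.\<close>

definition offset :: "nat \<Rightarrow> nat \<Rightarrow> nat" where
  "offset n a = (\<Sum>j<a. height n + s n j)"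

lemma r_ge_2: "r n \<ge> 2"
  using data by (simp add: rank_one_data_def)

lemma height_pos: "height n > 0"
  by (rule col_height_pos[OF data])

lemma width_Suc: "width (Suc n) = width n / real (r n)"
  by (simp add: rank_one_column.simps(2) cut_and_stack_def)

lemma width_pos: "width n > 0"
proof (induction n)
  case (Suc n)
  then show ?case using r_ge_2[of n] by (simp add: width_Suc)
qed simp

lemma width_le: "width n \<le> (1 / 2) ^ n"
proof (induction n)
  case (Suc n)
  have "width n / real (r n) \<le> width n / 2"
    using width_pos[of n] r_ge_2[of n] by (intro divide_left_mono) auto
  then show ?case using Suc by (simp add: width_Suc)
qed simp

lemma width_tendsto: "width \<longlonglongrightarrow> 0"
proof (rule tendsto_sandwich[OF _ _ tendsto_const])
  show "(\<lambda>n. (1 / 2 :: real) ^ n) \<longlonglongrightarrow> 0" by (rule LIMSEQ_power_zero) simp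
  show "eventually (\<lambda>n. 0 \<le> width n) sequentially"
    using width_pos by (auto intro: less_imp_le always_eventually)
  show "eventually (\<lambda>n. width n \<le> (1 / 2) ^ n) sequentially"
    using width_le by (auto intro: always_eventually)
qed

lemma width_less:
  assumes "e > 0"
  shows "\<exists>n\<ge>N. width n < e"
proof -
  have "eventually (\<lambda>n. width n < e) sequentially"
    by (rule order_tendstoD(2)[OF width_tendsto assms])
  then obtain M where "\<And>n. n \<ge> M \<Longrightarrow> width n < e" by (auto simp: eventually_sequentially)
  then show ?thesis by (intro exI[of _ "max N M"]) auto
qed

lemma bases_Suc:
  "col_bases (col (Suc n)) = concat (map (\<lambda>a. map (\<lambda>c. c + real a * width (Suc n)) (col_bases (col n))
     @ map (p n a) [0..<s n a]) [0..<r n])"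
  by (simp add: rank_one_column.simps(2) cut_and_stack_def)

lemma height_Suc: "height (Suc n) = offset n (r n)"
proof -
  have "height (Suc n) = (\<Sum>a\<leftarrow>[0..<r n]. height n + s n a)"
    unfolding col_height_def bases_Suc by (simp add: length_concat comp_def)
  also have "\<dots> = offset n (r n)"
    by (simp add: offset_def sum_set_upt_conv_sum_list_nat[symmetric] lessThan_atLeast0)
  finally show ?thesis .
qed

lemma base_Suc:
  assumes "a < r n" "i < height n"
  shows "base (Suc n) (offset n a + i) = base n i + real a * width (Suc n)"
  unfolding bases_Suc offset_def
  using nth_concat_map_upt[OF assms(1), of i "\<lambda>a. map (\<lambda>c. c + real a * width (Suc n)) (col_bases (col n))
     @ map (p n a) [0..<s n a]"] assms
  by (simp add: col_height_def nth_append)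

lemma base_Suc_spacer:
  assumes "a < r n" "q < s n a"
  shows "base (Suc n) (offset n a + height n + q) = p n a q"
  unfolding bases_Suc offset_def
  using nth_concat_map_upt[OF assms(1), of "height n + q" "\<lambda>a. map (\<lambda>c. c + real a * width (Suc n)) (col_bases (col n))
     @ map (p n a) [0..<s n a]"] assms
  by (simp add: col_height_def nth_append add.assoc)

lemma offset_0: "offset n 0 = 0"
  by (simp add: offset_def)

lemma offset_Suc: "offset n (Suc a) = offset n a + height n + s n a"
  by (simp add: offset_def)

lemma strict_mono_offset: "strict_mono (offset n)"
  using height_pos[of n] by (auto intro!: strict_monoI_Suc simp: offset_Suc)

lemma offset_less: "a < c \<Longrightarrow> offset n a < offset n c"
  using strict_mono_offset by (simp add: strict_mono_less)

lemma offset_add_less_height: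
  assumes "a < r n" "i < height n"
  shows "offset n a + i < height (Suc n)"
proof -
  have "offset n a + i < offset n (Suc a)" using assms by (simp add: offset_Suc)
  also have "\<dots> \<le> offset n (r n)"
    using assms strict_mono_offset[of n] by (simp add: strict_mono_less_eq)
  finally show ?thesis by (simp add: height_Suc)
qed

lemma level_index_cases:
  assumes "i < height (Suc n)"
  obtains (cut) a q where "a < r n" "q < height n" "i = offset n a + q"
  | (spacer) a q where "a < r n" "q < s n a" "i = offset n a + height n + q"
proof -
  obtain a q where aq: "a < r n" "q < height n + s n a" "i = offset n a + q"
    using sum_lessThan_decompose[of i "\<lambda>j. height n + s n j" "r n"] assms
    by (auto simp: height_Suc offset_def)
  show ?thesis
  proof (cases "q < height n")
    case True
    then show ?thesis using aq cut by blast
  next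
    case False
    then show ?thesis using aq spacer[of a "q - height n"] by simp
  qed
qed

lemma level_Suc:
  assumes "a < r n" "i < height n"
  shows "level (Suc n) (offset n a + i) =
    {base n i + real a * width (Suc n) ..< base n i + real (Suc a) * width (Suc n)}"
  using base_Suc[OF assms] by (simp add: col_level_def algebra_simps)

lemma level_Suc_spacer:
  assumes "a < r n" "q < s n a"
  shows "level (Suc n) (offset n a + height n + q) = spacer r s p n (a, q)"
  using base_Suc_spacer[OF assms] by (simp add: col_level_def spacer_def)

lemma level_Suc_subset:
  assumes "a < r n" "i < height n"
  shows "level (Suc n) (offset n a + i) \<subseteq> level n i"
proof -
  have "real (Suc a) * width (Suc n) \<le> real (r n) * width (Suc n)"
    using assms width_pos[of "Suc n"] by (intro mult_right_mono) auto
  also have "\<dots> = width n" using r_ge_2[of n] by (simp add: width_Suc)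
  finally have "real (Suc a) * width (Suc n) \<le> width n" .
  moreover have "0 \<le> real a * width (Suc n)" using width_pos[of "Suc n"] by simp
  ultimately show ?thesis
    unfolding level_Suc[OF assms] unfolding col_level_def by auto
qed

lemma level_Suc_ex:
  assumes "x \<in> level n i" "i < height n"
  shows "\<exists>a<r n. x \<in> level (Suc n) (offset n a + i)"
proof -
  let ?w = "width (Suc n)"
  have w: "?w > 0" by (rule width_pos)
  have rw: "real (r n) * ?w = width n" using r_ge_2[of n] by (simp add: width_Suc)
  define y where "y = x - base n i"
  have y: "0 \<le> y" "y < real (r n) * ?w" using assms(1) rw by (auto simp: y_def col_level_def)
  define a where "a = nat \<lfloor>y / ?w\<rfloor>"
  have fl: "real a = of_int \<lfloor>y / ?w\<rfloor>" using y w by (simp add: a_def)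
  have "real a \<le> y / ?w" "y / ?w < real a + 1" unfolding fl by linarith+
  then have a: "real a * ?w \<le> y" "y < (real a + 1) * ?w"
    using w by (simp_all add: field_simps)
  have "real a * ?w < real (r n) * ?w" using a y by linarith
  then have "a < r n" using w by simp
  moreover have "x \<in> level (Suc n) (offset n a + i)"
    using a unfolding level_Suc[OF \<open>a < r n\<close> assms(2)] y_def by (auto simp: algebra_simps)
  ultimately show ?thesis by blast
qed

lemma level_subset_col_union: "i < height n \<Longrightarrow> level n i \<subseteq> col_union (col n)"
  by (auto simp: col_union_def)

lemma col_unionE:
  assumes "x \<in> col_union (col n)"
  obtains i where "i < height n" "x \<in> level n i"
  using assms by (auto simp: col_union_def)

lemma sublevels_disjoint:
  assumes "a < c" "c < r n" "i < height n"
  shows "level (Suc n) (offset n a + i) \<inter> level (Suc n) (offset n c + i) = {}"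
proof -
  have "real (Suc a) * width (Suc n) \<le> real c * width (Suc n)"
    using assms width_pos[of "Suc n"] by (intro mult_right_mono) auto
  then show ?thesis using level_Suc[of a n i] level_Suc[of c n i] assms by auto
qed

text \<open>Two levels of the next column are pieces of one level in different subcolumns, pieces of
  different levels, or involve a spacer. The three cases rest on the cutting, the induction
  hypothesis and \<open>rank_one_data\<close> respectively.\<close>

lemma level_disjoint:
  assumes "i < height n" "j < height n" "i \<noteq> j"
  shows "level n i \<inter> level n j = {}"
  using assms
proof (induction n arbitrary: i j)
  case 0
  then show ?case by (simp add: col_height_def)
next
  case (Suc n)
  have sp: "spacer r s p n q \<inter> col_union (col n) = {}" if "q \<in> (SIGMA a:{..<r n}. {..<s n a})" for q
    using data that unfolding rank_one_data_def by blast
  have spd: "spacer r s p n q \<inter> spacer r s p n q' = {}"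
    if "q \<in> (SIGMA a:{..<r n}. {..<s n a})" "q' \<in> (SIGMA a:{..<r n}. {..<s n a})" "q \<noteq> q'" for q q'
    using data that unfolding rank_one_data_def disjoint_family_on_def by blast
  from Suc.prems(1) show ?case
  proof (cases rule: level_index_cases)
    case i: (cut a q)
    from Suc.prems(2) show ?thesis
    proof (cases rule: level_index_cases)
      case j: (cut c q')
      show ?thesis
      proof (cases "q = q'")
        case True
        then have "a \<noteq> c" using i j Suc.prems by auto
        then have "a < c \<or> c < a" by linarith
        then show ?thesis using sublevels_disjoint[of a c n q] sublevels_disjoint[of c a n q] i j True by blast
      next
        case False
        then show ?thesis
          using Suc.IH[of q q'] i j level_Suc_subset[of a n q] level_Suc_subset[of c n q'] by blast
      qed
    next
      case j: (spacer c q')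
      then show ?thesis
        using i sp[of "(c, q')"] level_Suc_spacer[of c n q'] level_Suc_subset[of a n q]
          level_subset_col_union[of q n] by auto
    qed
  next
    case i: (spacer a q)
    from Suc.prems(2) show ?thesis
    proof (cases rule: level_index_cases)
      case j: (cut c q')
      then show ?thesis
        using i sp[of "(a, q)"] level_Suc_spacer[of a n q] level_Suc_subset[of c n q']
          level_subset_col_union[of q' n] by auto
    next
      case j: (spacer c q')
      then have "(a, q) \<noteq> (c, q')" using i Suc.prems by auto
      then show ?thesis
        using i j spd[of "(a, q)" "(c, q')"] level_Suc_spacer by simp
    qed
  qed
qed

lemma level_unique:
  assumes "x \<in> level n i" "x \<in> level n j" "i < height n" "j < height n"
  shows "i = j"
  using level_disjoint[of i n j] assms by blast

lemma col_union_mono: "n \<le> m \<Longrightarrow> col_union (col n) \<subseteq> col_union (col m)"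
proof (induction rule: dec_induct)
  case (step m)
  have "col_union (col m) \<subseteq> col_union (col (Suc m))"
  proof
    fix x assume "x \<in> col_union (col m)"
    then obtain i where i: "i < height m" "x \<in> level m i" by (rule col_unionE)
    then obtain a where "a < r m" "x \<in> level (Suc m) (offset m a + i)" using level_Suc_ex by blast
    then show "x \<in> col_union (col (Suc m))"
      using i level_subset_col_union[OF offset_add_less_height] by blast
  qed
  then show ?case using step by blast
qed simp

lemma level_subset_space: "i < height n \<Longrightarrow> level n i \<subseteq> X"
  using level_subset_col_union by (auto simp: rank_one_space_def)

lemma spaceE:
  assumes "x \<in> X"
  obtains N where "\<And>n. n \<ge> N \<Longrightarrow> x \<in> col_union (col n)"
proof -
  obtain N where "x \<in> col_union (col N)" using assms by (auto simp: rank_one_space_def)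
  then show ?thesis using that col_union_mono by blast
qed

section \<open>The rank-one map\<close>

lemma col_map_level:
  assumes "Suc i < height n" "x \<in> level n i"
  shows "col_map (col n) x = base n (Suc i) + (x - base n i)"
proof -
  have "(THE i. Suc i < height n \<and> x \<in> level n i) = i"
    using assms level_unique[of x n] by (intro the_equality) auto
  then show ?thesis using assms by (auto simp: col_map_def Let_def)
qed

text \<open>Neighbouring levels \<open>i\<close> and \<open>i + 1\<close> are cut alike and stay
  stacked inside each subcolumn, so a point below the top keeps both this position and its
  translation distance. Hence the column maps are eventually constant at each such point.\<close>

lemma col_map_stable:
  assumes "Suc i < height n" "x \<in> level n i" "n \<le> m"
  shows "\<exists>j. Suc j < height m \<and> x \<in> level m j \<and> base m (Suc j) - base m j = base n (Suc i) - base n i"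
  using assms(3)
proof (induction rule: dec_induct)
  case base
  show ?case using assms by blast
next
  case (step m)
  then obtain j where j: "Suc j < height m" "x \<in> level m j"
    "base m (Suc j) - base m j = base n (Suc i) - base n i" by blast
  then obtain a where a: "a < r m" "x \<in> level (Suc m) (offset m a + j)"
    using level_Suc_ex[of x m j] by auto
  have "Suc (offset m a + j) < height (Suc m)"
    using offset_add_less_height[OF a(1) j(1)] by simp
  moreover have "base (Suc m) (Suc (offset m a + j)) - base (Suc m) (offset m a + j) = base m (Suc j) - base m j"
    using base_Suc[OF a(1) j(1)] base_Suc[OF a(1), of j] j(1) by simp
  ultimately show ?case using a j(3) by (intro exI[of _ "offset m a + j"]) simp
qed

lemma map_level:
  assumes "Suc i < height n" "x \<in> level n i"
  shows "T x = base n (Suc i) + (x - base n i)"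
proof -
  have "col_map (col m) x = base n (Suc i) + (x - base n i)" if nm: "n \<le> m" for m
  proof -
    obtain j where "Suc j < height m" "x \<in> level m j"
      "base m (Suc j) - base m j = base n (Suc i) - base n i"
      using col_map_stable[OF assms nm] by blast
    then show ?thesis using col_map_level[of j m x] by simp
  qed
  then have "(\<lambda>m. col_map (col m) x) \<longlonglongrightarrow> base n (Suc i) + (x - base n i)"
    by (intro tendsto_eventually) (auto simp: eventually_sequentially)
  then show ?thesis unfolding rank_one_map_def by (rule limI)
qed

text \<open>A point in the top level of all columns would have vanishing distance to the common right
  endpoint of these levels, which does not belong to them.\<close>

lemma not_always_top:
  assumes "x \<in> X"
  shows "\<exists>n\<ge>N. \<exists>i. Suc i < height n \<and> x \<in> level n i"
proof (rule ccontr)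
  assume nex: "\<not> (\<exists>n\<ge>N. \<exists>i. Suc i < height n \<and> x \<in> level n i)"
  obtain N0 where N0: "x \<in> col_union (col n)" if "n \<ge> N0" for n using spaceE[OF assms] by blast
  define M where "M = max N N0"
  have top: "x \<in> level n (height n - 1)" if "n \<ge> M" for n
  proof -
    have "x \<in> col_union (col n)" using N0 that by (simp add: M_def)
    then obtain i where i: "i < height n" "x \<in> level n i" by (rule col_unionE)
    then have "\<not> Suc i < height n" using nex that by (auto simp: M_def)
    then have "i = height n - 1" using i by linarith
    then show ?thesis using i by simp
  qed
  define e where "e n = base n (height n - 1) + width n" for n
  have e: "e n = e M" if "n \<ge> M" for n
    using that
  proof (induction rule: dec_induct)
    case (step n)
    have hn: "height n - 1 < height n" using height_pos by simp
    then obtain a where a: "a < r n" "x \<in> level (Suc n) (offset n a + (height n - 1))"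
      using level_Suc_ex[OF top[of n]] step by auto
    have lt: "offset n a + (height n - 1) < height (Suc n)"
      by (rule offset_add_less_height[OF a(1) hn])
    have eq: "offset n a + (height n - 1) = height (Suc n) - 1"
      by (rule level_unique[OF a(2) top lt]) (use step height_pos[of "Suc n"] in auto)
    \<comment> \<open>A further subcolumn would put levels above the one containing
      \<open>x\<close>. So the piece is the rightmost one, and the right endpoint stays put.\<close>
    have "Suc a = r n"
    proof (rule ccontr)
      assume "Suc a \<noteq> r n"
      then have "Suc a < r n" using a by simp
      then have "offset n (Suc a) < offset n (r n)" by (rule offset_less)
      then show False using eq lt height_pos[of n] unfolding height_Suc offset_Suc by linarith
    qed
    then have "real (r n) = real a + 1" by linarith
    then have "e (Suc n) = base n (height n - 1) + real (r n) * width (Suc n)"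
      using base_Suc[OF a(1) hn] unfolding e_def eq[symmetric] by (simp add: algebra_simps)
    then show ?case using step r_ge_2[of n] by (simp add: e_def width_Suc)
  qed simp
  have "e M - x > 0" using top[of M] by (auto simp: e_def col_level_def)
  then obtain n where n: "n \<ge> M" "width n < e M - x" using width_less by blast
  then show False using top[of n] e[of n] by (auto simp: e_def col_level_def)
qed

lemma map_in_level:
  assumes "Suc i < height n" "x \<in> level n i"
  shows "T x \<in> level n (Suc i)"
  using map_level[OF assms] assms(2) by (auto simp: col_level_def)

lemma map_in_space:
  assumes "x \<in> X"
  shows "T x \<in> X"
proof -
  obtain n i where "Suc i < height n" "x \<in> level n i" using not_always_top[OF assms] by blast
  then show ?thesis using map_in_level[of i n x] level_subset_space[of "Suc i" n] by blast
qed

text \<open>Being below the top persists in later columns, so both points can be viewed in one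
  column, where \<open>T\<close> moves each level by a translation onto the next one.\<close>

lemma inj_on_map: "inj_on T X"
proof (rule inj_onI)
  fix x y assume x: "x \<in> X" and y: "y \<in> X" and eq: "T x = T y"
  obtain n i where i: "Suc i < height n" "x \<in> level n i" using not_always_top[OF x] by blast
  obtain m j where j: "m \<ge> n" "Suc j < height m" "y \<in> level m j" using not_always_top[OF y] by blast
  obtain i' where i': "Suc i' < height m" "x \<in> level m i'" using col_map_stable[OF i j(1)] by blast
  have "T x \<in> level m (Suc i')" "T y \<in> level m (Suc j)"
    using map_in_level[OF i'] map_in_level[OF j(2,3)] by auto
  then have "i' = j" using level_unique[of "T x" m "Suc i'" "Suc j"] eq i' j by simp
  then have "T x = base m (Suc j) + (x - base m j)" using map_level[OF i'] by (simp only:)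
  then show "x = y" using map_level[OF j(2,3)] eq by linarith
qed

lemma map_preimage_level:
  assumes "Suc i < height n" "y \<in> level n (Suc i)"
  shows "\<exists>x\<in>level n i. T x = y"
proof
  show x: "base n i + (y - base n (Suc i)) \<in> level n i" using assms by (auto simp: col_level_def)
  show "T (base n i + (y - base n (Suc i))) = y" using map_level[OF assms(1) x] by simp
qed

lemma base_0: "base n 0 = 0"
proof (induction n)
  case (Suc n)
  then show ?case using base_Suc[of 0 n 0] r_ge_2[of n] height_pos[of n]
    by (simp add: offset_0)
qed simp

text \<open>The bottom level of column \<open>n\<close> is the interval from 0 to
  \<open>width n\<close>, which shrinks to the point 0.\<close>

lemma not_bottom:
  assumes "x \<in> X" "x \<noteq> 0"
  shows "\<exists>n i. Suc i < height n \<and> x \<in> level n (Suc i)"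
proof -
  obtain N where N: "\<And>n. n \<ge> N \<Longrightarrow> x \<in> col_union (col n)" using spaceE[OF assms(1)] by blast
  obtain n where n: "n \<ge> N" "width n < \<bar>x\<bar>" using width_less[of "\<bar>x\<bar>" N] assms by auto
  obtain i where i: "i < height n" "x \<in> level n i" using N[OF n(1)] by (rule col_unionE)
  have "i \<noteq> 0"
  proof
    assume "i = 0"
    then have "0 \<le> x" "x < width n" using i base_0 by (auto simp: col_level_def)
    then show False using n by simp
  qed
  then obtain j where "i = Suc j" by (cases i) auto
  then show ?thesis using i by blast
qed

lemma funpow_in_space: "x \<in> X \<Longrightarrow> (T ^^ d) x \<in> X"
  by (induction d) (auto intro: map_in_space)

lemma inj_on_funpow: "inj_on (T ^^ d) X"
proof (induction d)
  case (Suc d)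
  have "inj_on T ((T ^^ d) ` X)" by (rule inj_on_subset[OF inj_on_map]) (auto intro: funpow_in_space)
  then show ?case using comp_inj_on[OF Suc] by (simp only: funpow.simps)
qed simp

lemma funpow_level:
  assumes "i + d < height n" "x \<in> level n i"
  shows "(T ^^ d) x \<in> level n (i + d)"
  using assms(1)
proof (induction d)
  case (Suc d)
  then show ?case using map_in_level[of "i + d" n "(T ^^ d) x"] by simp
qed (simp add: assms)

lemma funpow_preimage_level:
  assumes "i + d < height n" "y \<in> level n (i + d)"
  shows "\<exists>x\<in>level n i. (T ^^ d) x = y"
  using assms
proof (induction d arbitrary: y)
  case (Suc d)
  obtain z where z: "z \<in> level n (i + d)" "T z = y"
    using map_preimage_level[of "i + d" n y] Suc.prems by auto
  obtain x where "x \<in> level n i" "(T ^^ d) x = z" using Suc.IH[OF _ z(1)] Suc.prems by auto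
  then show ?case using z by (intro bexI[of _ x]) auto
qed simp

text \<open>The backward direction combines surjectivity of \<open>T ^^ d\<close> from level
  \<open>i\<close> to level \<open>i + d\<close> with its injectivity on all of \<open>X\<close>. It
  makes preimages of boxes exact.\<close>

lemma funpow_in_level_iff:
  assumes "i + d < height n" "x \<in> X"
  shows "(T ^^ d) x \<in> level n (i + d) \<longleftrightarrow> x \<in> level n i"
proof
  assume "(T ^^ d) x \<in> level n (i + d)"
  then obtain y where y: "y \<in> level n i" "(T ^^ d) y = (T ^^ d) x"
    using funpow_preimage_level[OF assms(1)] by blast
  have "y \<in> X" using y level_subset_space[of i n] assms by auto
  then show "x \<in> level n i" using inj_onD[OF inj_on_funpow y(2)] y(1) assms(2) by simp
qed (rule funpow_level[OF assms(1)])

end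

section \<open>Measurability and measure preservation of the rank-one map\<close>

lemma emeasure_lebesgue_translation:
  fixes a :: "'a::euclidean_space"
  shows "emeasure lebesgue ((+) a ` S) = emeasure lebesgue S"
  using emeasure_lebesgue_affine[of 1 a S] by (simp add: ac_simps cong: image_cong_simp)

context rank_one
begin

abbreviation "M \<equiv> rank_one_measure r s p"

lemma level_borel [measurable]: "level n i \<in> sets borel"
  by (simp add: col_level_def)

lemma col_union_borel [measurable]: "col_union (col n) \<in> sets borel"
  unfolding col_union_def by (intro sets.finite_UN) auto

lemma space_borel [measurable]: "X \<in> sets borel"
  unfolding rank_one_space_def by (intro sets.countable_UN) auto

lemma space_M: "space M = X"
  by (simp add: rank_one_measure_def space_restrict_space)

lemma sets_M: "A \<in> sets M \<longleftrightarrow> A \<in> sets lebesgue \<and> A \<subseteq> X"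
  unfolding rank_one_measure_def by (subst sets_restrict_space_iff) auto

lemma emeasure_M: "A \<subseteq> X \<Longrightarrow> emeasure M A = emeasure lebesgue A"
  unfolding rank_one_measure_def by (intro emeasure_restrict_space) auto

lemma level_sets_M: "i < height n \<Longrightarrow> level n i \<in> sets M"
  using level_subset_space by (simp add: sets_M)

lemma emeasure_level: "i < height n \<Longrightarrow> emeasure M (level n i) = ennreal (width n)"
  using level_subset_space width_pos[of n] by (simp add: emeasure_M col_level_def)

lemma col_union_subset_space: "col_union (col n) \<subseteq> X"
  by (auto simp: rank_one_space_def)

lemma emeasure_col_union_finite: "emeasure M (col_union (col n)) < \<infinity>"
proof -
  have "emeasure M (col_union (col n)) \<le> (\<Sum>i<height n. emeasure M (level n i))"
    unfolding col_union_def by (rule emeasure_subadditive_finite) (auto intro: level_sets_M)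
  also have "\<dots> < \<infinity>" by (simp add: emeasure_level ennreal_mult_less_top of_nat_less_top)
  finally show ?thesis .
qed

lemma sigma_finite_M: "sigma_finite_measure M"
proof
  show "\<exists>A. countable A \<and> A \<subseteq> sets M \<and> \<Union>A = space M \<and> (\<forall>a\<in>A. emeasure M a \<noteq> \<infinity>)"
    using emeasure_col_union_finite col_union_subset_space
    by (intro exI[of _ "range (\<lambda>n. col_union (col n))"])
      (auto simp: space_M sets_M less_top[symmetric] rank_one_space_def)
qed

definition shift :: "nat \<Rightarrow> nat \<Rightarrow> real" where
  "shift n i = base n (Suc i) - base n i"

lemma image_map_level:
  assumes "Suc i < height n"
  shows "T ` (A \<inter> level n i) = (+) (shift n i) ` (A \<inter> level n i)"
  using map_level[OF assms] by (intro image_cong) (auto simp: shift_def)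

lemma vimage_map_level:
  assumes "Suc i < height n"
  shows "T -` A \<inter> level n i = (+) (- shift n i) ` (A \<inter> level n (Suc i))"
proof
  show "T -` A \<inter> level n i \<subseteq> (+) (- shift n i) ` (A \<inter> level n (Suc i))"
  proof
    fix x assume x: "x \<in> T -` A \<inter> level n i"
    then have "x = - shift n i + T x" using map_level[OF assms, of x] by (simp add: shift_def)
    moreover have "T x \<in> A \<inter> level n (Suc i)" using x map_in_level[OF assms] by auto
    ultimately show "x \<in> (+) (- shift n i) ` (A \<inter> level n (Suc i))" by (rule image_eqI)
  qed
next
  show "(+) (- shift n i) ` (A \<inter> level n (Suc i)) \<subseteq> T -` A \<inter> level n i"
  proof clarify
    fix y assume y: "y \<in> A" "y \<in> level n (Suc i)"
    then have l: "- shift n i + y \<in> level n i" by (auto simp: col_level_def shift_def)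
    then have "T (- shift n i + y) = y" using map_level[OF assms l] by (simp add: shift_def)
    then show "- shift n i + y \<in> T -` A \<inter> level n i" using l y by simp
  qed
qed

text \<open>Countably many pieces on each of which \<open>T\<close> is a translation; this reduces
  images and preimages of Lebesgue sets to translates.\<close>

lemma space_eq_UN_levels: "X = (\<Union>n. \<Union>i\<in>{i. Suc i < height n}. level n i)"
proof
  show "X \<subseteq> (\<Union>n. \<Union>i\<in>{i. Suc i < height n}. level n i)" using not_always_top by blast
  show "(\<Union>n. \<Union>i\<in>{i. Suc i < height n}. level n i) \<subseteq> X"
    using level_subset_space Suc_lessD by blast
qed

lemma image_map_sets:
  assumes "A \<in> sets M"
  shows "T ` A \<in> sets M"
proof -
  have A: "A \<in> sets lebesgue" "A \<subseteq> X" using assms by (auto simp: sets_M)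
  have "A = (\<Union>n. \<Union>i\<in>{i. Suc i < height n}. A \<inter> level n i)"
    using A(2) space_eq_UN_levels by blast
  then have "T ` A = (\<Union>n. \<Union>i\<in>{i. Suc i < height n}. T ` (A \<inter> level n i))"
    by (metis (no_types, lifting) SUP_cong image_UN)
  also have "\<dots> = (\<Union>n. \<Union>i\<in>{i. Suc i < height n}. (+) (shift n i) ` (A \<inter> level n i))"
    using image_map_level by auto
  also have "\<dots> \<in> sets lebesgue"
    using A(1) by (intro sets.countable_UN'' lebesgue_sets_translation sets.Int) auto
  finally have "T ` A \<in> sets lebesgue" .
  moreover have "T ` A \<subseteq> X" using A(2) map_in_space by blast
  ultimately show ?thesis by (simp add: sets_M)
qed

lemma measurable_map: "T \<in> measurable M M"
proof (rule measurableI)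
  fix A assume "A \<in> sets M"
  then have A: "A \<in> sets lebesgue" by (simp add: sets_M)
  have "T -` A \<inter> X = (\<Union>n. \<Union>i\<in>{i. Suc i < height n}. T -` A \<inter> level n i)"
    by (subst space_eq_UN_levels) blast
  also have "\<dots> = (\<Union>n. \<Union>i\<in>{i. Suc i < height n}. (+) (- shift n i) ` (A \<inter> level n (Suc i)))"
    using vimage_map_level by auto
  also have "\<dots> \<in> sets lebesgue"
    using A by (intro sets.countable_UN'' lebesgue_sets_translation sets.Int) auto
  finally show "T -` A \<inter> space M \<in> sets M" by (simp add: sets_M space_M)
qed (simp add: space_M map_in_space)

lemma measurable_inverse_map: "inverse_map X T \<in> measurable M M"
proof (rule measurableI)
  fix x assume x: "x \<in> space M"
  then show "inverse_map X T x \<in> space M"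
    unfolding space_M inverse_map_def by (auto intro: inv_into_into)
next
  fix A assume A: "A \<in> sets M"
  have "A \<subseteq> X" using A by (simp add: sets_M)
  have "inverse_map X T -` A \<inter> space M = T ` A \<union> (A - T ` X)"
  proof (rule set_eqI)
    fix x
    show "x \<in> inverse_map X T -` A \<inter> space M \<longleftrightarrow> x \<in> T ` A \<union> (A - T ` X)"
    proof (cases "x \<in> T ` X")
      case True
      then obtain y where y: "y \<in> X" "x = T y" by blast
      then have "inverse_map X T x = y" using inj_on_map by (simp add: inverse_map_def)
      moreover have "x \<in> T ` A \<longleftrightarrow> y \<in> A"
        using y inj_on_map \<open>A \<subseteq> X\<close> by (auto dest: inj_onD)
      ultimately show ?thesis using True y map_in_space by (auto simp: space_M)
    next
      case False
      then show ?thesis using \<open>A \<subseteq> X\<close> by (auto simp: space_M inverse_map_def)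
    qed
  qed
  also have "\<dots> \<in> sets M"
    using image_map_sets[OF A] A image_map_sets[OF sets.top] by (auto simp: space_M)
  finally show "inverse_map X T -` A \<inter> space M \<in> sets M" .
qed

text \<open>The part of the preimage of \<open>A\<close> below the top of column \<open>n\<close>
  (\<open>Xn\<close>) is carried by translations onto the part of \<open>A\<close> above the bottom
  (\<open>Yn\<close>). Both parts increase with \<open>n\<close>, so continuity from below applies
  even in infinite measure.\<close>

lemma measure_preserving_map: "measure_preserving M T"
  unfolding measure_preserving_def
proof (intro conjI ballI measurable_map)
  fix A assume A: "A \<in> sets M"
  define I where "I n = {i. Suc i < height n}" for n
  define Xn where "Xn n = (\<Union>i\<in>I n. T -` A \<inter> level n i)" for n
  define Yn where "Yn n = (\<Union>i\<in>I n. A \<inter> level n (Suc i))" for n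
  have fin: "finite (I n)" for n
    unfolding I_def by (rule finite_subset[of _ "{..<height n}"]) auto
  have Al: "A \<in> sets lebesgue" "A \<subseteq> X" using A by (auto simp: sets_M)
  have sX: "T -` A \<inter> level n i \<in> sets M" if "i \<in> I n" for n i
  proof -
    have "T -` A \<inter> level n i = (T -` A \<inter> space M) \<inter> level n i"
      using level_subset_space[of i n] that by (auto simp: space_M I_def)
    also have "\<dots> \<in> sets M"
      by (rule sets.Int[OF measurable_sets[OF measurable_map A] level_sets_M])
        (use that in \<open>auto simp: I_def\<close>)
    finally show ?thesis .
  qed
  have sY: "A \<inter> level n (Suc i) \<in> sets M" if "i \<in> I n" for n i
    using that A level_sets_M[of "Suc i" n] by (auto simp: I_def)
  have eq: "emeasure M (Xn n) = emeasure M (Yn n)" for n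
  proof -
    have "emeasure M (Xn n) = (\<Sum>i\<in>I n. emeasure M (T -` A \<inter> level n i))"
      unfolding Xn_def
    proof (rule sum_emeasure[symmetric])
      show "disjoint_family_on (\<lambda>i. T -` A \<inter> level n i) (I n)"
        unfolding disjoint_family_on_def
      proof (intro ballI impI)
        fix i j assume "i \<in> I n" "j \<in> I n" "i \<noteq> j"
        then have "level n i \<inter> level n j = {}" by (intro level_disjoint) (auto simp: I_def)
        then show "(T -` A \<inter> level n i) \<inter> (T -` A \<inter> level n j) = {}" by blast
      qed
    qed (use sX fin in auto)
    also have "\<dots> = (\<Sum>i\<in>I n. emeasure M (A \<inter> level n (Suc i)))"
    proof (rule sum.cong)
      fix i assume i: "i \<in> I n"
      have "emeasure M (T -` A \<inter> level n i) = emeasure lebesgue (T -` A \<inter> level n i)"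
        using sX[OF i] by (intro emeasure_M) (auto simp: sets_M)
      also have "\<dots> = emeasure lebesgue (A \<inter> level n (Suc i))"
        using i by (simp only: I_def mem_Collect_eq vimage_map_level emeasure_lebesgue_translation)
      also have "\<dots> = emeasure M (A \<inter> level n (Suc i))"
        using sY[OF i] by (intro emeasure_M[symmetric]) (auto simp: sets_M)
      finally show "emeasure M (T -` A \<inter> level n i) = emeasure M (A \<inter> level n (Suc i))" .
    qed simp
    also have "\<dots> = emeasure M (Yn n)"
      unfolding Yn_def
    proof (rule sum_emeasure)
      show "disjoint_family_on (\<lambda>i. A \<inter> level n (Suc i)) (I n)"
        unfolding disjoint_family_on_def
      proof (intro ballI impI)
        fix i j assume "i \<in> I n" "j \<in> I n" "i \<noteq> j"
        then have "level n (Suc i) \<inter> level n (Suc j) = {}" by (intro level_disjoint) (auto simp: I_def)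
        then show "(A \<inter> level n (Suc i)) \<inter> (A \<inter> level n (Suc j)) = {}" by blast
      qed
    qed (use sY fin in auto)
    finally show ?thesis .
  qed
  have "incseq Xn"
  proof (intro incseq_SucI subsetI)
    fix n x assume "x \<in> Xn n"
    then obtain i where "Suc i < height n" "x \<in> level n i" "T x \<in> A" by (auto simp: Xn_def I_def)
    then show "x \<in> Xn (Suc n)" using col_map_stable[of i n x "Suc n"] by (auto simp: Xn_def I_def)
  qed
  moreover have "(\<Union>n. Xn n) = T -` A \<inter> space M"
    unfolding space_M by (subst space_eq_UN_levels) (auto simp: Xn_def I_def)
  moreover have "Xn n \<in> sets M" for n unfolding Xn_def by (rule sets.finite_UN[OF fin sX])
  then have "range Xn \<subseteq> sets M" by auto
  ultimately have 1: "(SUP n. emeasure M (Xn n)) = emeasure M (T -` A \<inter> space M)"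
    using SUP_emeasure_incseq[of Xn M] by simp
  have "incseq Yn"
  proof (intro incseq_SucI subsetI)
    fix n y assume "y \<in> Yn n"
    then obtain i where i: "Suc i < height n" "y \<in> level n (Suc i)" "y \<in> A" by (auto simp: Yn_def I_def)
    then obtain x where x: "x \<in> level n i" "T x = y" using map_preimage_level by blast
    obtain j where "Suc j < height (Suc n)" "x \<in> level (Suc n) j"
      using col_map_stable[OF i(1) x(1), of "Suc n"] by auto
    then show "y \<in> Yn (Suc n)" using i x map_in_level[of j "Suc n" x] by (auto simp: Yn_def I_def)
  qed
  moreover have "Yn n \<in> sets M" for n unfolding Yn_def by (rule sets.finite_UN[OF fin sY])
  then have sYn: "range Yn \<subseteq> sets M" by auto
  ultimately have 2: "(SUP n. emeasure M (Yn n)) = emeasure M (\<Union>n. Yn n)"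
    using SUP_emeasure_incseq[of Yn M] by simp
  \<comment> \<open>Only the point 0 can stay in the bottom level forever, so the sets
    \<open>Yn n\<close> exhaust \<open>A\<close> up to a null set.\<close>
  have "A - {0} \<subseteq> (\<Union>n. Yn n)"
  proof
    fix x assume x: "x \<in> A - {0}"
    then obtain n i where "Suc i < height n" "x \<in> level n (Suc i)" using not_bottom[of x] Al by blast
    then show "x \<in> (\<Union>n. Yn n)" using x by (auto simp: Yn_def I_def)
  qed
  then have sub: "A \<subseteq> (\<Union>n. Yn n) \<union> ({0} \<inter> X)" using Al by auto
  have z: "{0} \<inter> X \<in> null_sets M"
    by (cases "0 \<in> X") (auto simp: null_sets_def sets_M emeasure_M)
  have "emeasure M A \<le> emeasure M ((\<Union>n. Yn n) \<union> ({0} \<inter> X))"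
    using sub sYn z by (intro emeasure_mono) auto
  also have "\<dots> = emeasure M (\<Union>n. Yn n)" using sYn z by (intro emeasure_Un_null_set) auto
  finally have "emeasure M A \<le> emeasure M (\<Union>n. Yn n)" .
  moreover have "emeasure M (\<Union>n. Yn n) \<le> emeasure M A"
    by (rule emeasure_mono[OF _ A]) (auto simp: Yn_def)
  ultimately have "emeasure M (\<Union>n. Yn n) = emeasure M A" by simp
  then show "emeasure M (T -` A \<inter> space M) = emeasure M A" using 1 2 eq by simp
qed

end

section \<open>Products of levels\<close>

locale rank_one_product = rank_one +
  fixes k :: nat
  assumes k: "k \<ge> 1"
begin

abbreviation "P \<equiv> Pi\<^sub>M {..<k} (\<lambda>_. M)"
abbreviation "S \<equiv> product_map k T"

definition level_box :: "nat \<Rightarrow> (nat \<Rightarrow> nat) \<Rightarrow> (nat \<Rightarrow> real) set" where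
  "level_box n j = (\<Pi>\<^sub>E i\<in>{..<k}. level n (j i))"

text \<open>Extensional functions, so that the set is finite and distinct members differ in a
  coordinate below \<open>k\<close>, which makes their boxes disjoint.\<close>

definition indices :: "nat \<Rightarrow> (nat \<Rightarrow> nat) set" where
  "indices n = ({..<k} \<rightarrow>\<^sub>E {..<height n})"

lemma space_P: "space P = ({..<k} \<rightarrow>\<^sub>E X)"
  by (simp add: space_PiM space_M)

lemma product_sigma_finite_M: "product_sigma_finite (\<lambda>_. M)"
  by (simp add: product_sigma_finite_def sigma_finite_M)

lemma measure_preserving_S: "measure_preserving P S"
  by (rule measure_preserving_product_map[OF sigma_finite_M measure_preserving_map])

lemma S_funpow: "x \<in> space P \<Longrightarrow> (S ^^ d) x = (\<lambda>i\<in>{..<k}. (T ^^ d) (x i))"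
  using product_map_funpow[of x k d T] by (simp add: space_P PiE_def product_map_def)

lemma box_sets: "j \<in> {..<k} \<rightarrow> {..<height n} \<Longrightarrow> level_box n j \<in> sets P"
  unfolding level_box_def by (intro sets_PiM_I_finite) (auto intro: level_sets_M)

lemma emeasure_box:
  assumes "j \<in> {..<k} \<rightarrow> {..<height n}"
  shows "emeasure P (level_box n j) = ennreal (width n ^ k)"
proof -
  have lev: "level n (j i) \<in> sets M" "emeasure M (level n (j i)) = ennreal (width n)" if "i \<in> {..<k}" for i
    using assms that by (auto intro!: level_sets_M emeasure_level)
  have "emeasure P (level_box n j) = (\<Prod>i<k. emeasure M (level n (j i)))"
    unfolding level_box_def
    by (rule product_sigma_finite.emeasure_PiM[OF product_sigma_finite_M]) (use lev in auto)
  also have "\<dots> = (\<Prod>i<k. ennreal (width n))" using lev by (intro prod.cong) auto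
  also have "\<dots> = ennreal (width n ^ k)" using width_pos[of n] by (simp add: ennreal_power)
  finally show ?thesis .
qed

lemma measure_box: "j \<in> {..<k} \<rightarrow> {..<height n} \<Longrightarrow> measure P (level_box n j) = width n ^ k"
  using emeasure_box width_pos[of n] by (simp add: measure_def)

lemma emeasure_Int_box_finite:
  assumes "j \<in> {..<k} \<rightarrow> {..<height n}"
  shows "emeasure P (A \<inter> level_box n j) \<noteq> \<infinity>"
proof -
  have "emeasure P (A \<inter> level_box n j) \<le> emeasure P (level_box n j)"
    using box_sets[OF assms] by (intro emeasure_mono) auto
  also have "\<dots> < \<infinity>" by (simp add: emeasure_box[OF assms])
  finally show ?thesis by simp
qed

lemma box_subset_space: "j \<in> {..<k} \<rightarrow> {..<height n} \<Longrightarrow> level_box n j \<subseteq> space P"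
  using sets.sets_into_space[OF box_sets] .

lemma box_disjoint:
  assumes "j \<in> {..<k} \<rightarrow> {..<height n}" "j' \<in> {..<k} \<rightarrow> {..<height n}" "i < k" "j i \<noteq> j' i"
  shows "level_box n j \<inter> level_box n j' = {}"
proof -
  have "level n (j i) \<inter> level n (j' i) = {}" using assms by (intro level_disjoint) auto
  then show ?thesis using assms(3) by (auto simp: level_box_def PiE_iff)
qed

text \<open>Here \<open>a i\<close> chooses the subcolumn used in coordinate \<open>i\<close>; the
  diagonal subboxes of the overview are those with constant \<open>a\<close>.\<close>

definition subindex :: "nat \<Rightarrow> (nat \<Rightarrow> nat) \<Rightarrow> (nat \<Rightarrow> nat) \<Rightarrow> nat \<Rightarrow> nat" where
  "subindex n j a = (\<lambda>i. offset n (a i) + j i)"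

lemma subindex_funcset:
  assumes "j \<in> {..<k} \<rightarrow> {..<height n}" "a \<in> {..<k} \<rightarrow> {..<r n}"
  shows "subindex n j a \<in> {..<k} \<rightarrow> {..<height (Suc n)}"
proof
  fix i assume "i \<in> {..<k}"
  then have "offset n (a i) + j i < height (Suc n)"
    using assms by (intro offset_add_less_height) auto
  then show "subindex n j a i \<in> {..<height (Suc n)}" by (simp add: subindex_def)
qed

lemma box_eq_UN:
  assumes j: "j \<in> {..<k} \<rightarrow> {..<height n}"
  shows "level_box n j = (\<Union>a\<in>{..<k} \<rightarrow>\<^sub>E {..<r n}. level_box (Suc n) (subindex n j a))"
proof
  show "level_box n j \<subseteq> (\<Union>a\<in>{..<k} \<rightarrow>\<^sub>E {..<r n}. level_box (Suc n) (subindex n j a))"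
  proof
    fix x assume x: "x \<in> level_box n j"
    have "\<forall>i\<in>{..<k}. \<exists>a<r n. x i \<in> level (Suc n) (offset n a + j i)"
      using x j by (intro ballI level_Suc_ex) (auto simp: level_box_def PiE_iff)
    then obtain a where a: "\<forall>i\<in>{..<k}. a i < r n \<and> x i \<in> level (Suc n) (offset n (a i) + j i)"
      by metis
    then have "x \<in> level_box (Suc n) (subindex n j (restrict a {..<k}))"
      using x by (auto simp: level_box_def PiE_iff subindex_def)
    moreover have "restrict a {..<k} \<in> {..<k} \<rightarrow>\<^sub>E {..<r n}" using a by auto
    ultimately show "x \<in> (\<Union>a\<in>{..<k} \<rightarrow>\<^sub>E {..<r n}. level_box (Suc n) (subindex n j a))" by blast
  qed
  show "(\<Union>a\<in>{..<k} \<rightarrow>\<^sub>E {..<r n}. level_box (Suc n) (subindex n j a)) \<subseteq> level_box n j"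
  proof (rule UN_least)
    fix a assume a: "a \<in> {..<k} \<rightarrow>\<^sub>E {..<r n}"
    have "level (Suc n) (subindex n j a i) \<subseteq> level n (j i)" if "i \<in> {..<k}" for i
      using a j that unfolding subindex_def by (intro level_Suc_subset) auto
    then show "level_box (Suc n) (subindex n j a) \<subseteq> level_box n j" unfolding level_box_def by (rule PiE_mono)
  qed
qed

lemma measure_Int_box_eq_sum:
  assumes j: "j \<in> {..<k} \<rightarrow> {..<height n}" and A: "A \<in> sets P"
  shows "measure P (A \<inter> level_box n j) =
    (\<Sum>a\<in>{..<k} \<rightarrow>\<^sub>E {..<r n}. measure P (A \<inter> level_box (Suc n) (subindex n j a)))"
proof -
  have sub: "subindex n j a \<in> {..<k} \<rightarrow> {..<height (Suc n)}" if "a \<in> {..<k} \<rightarrow>\<^sub>E {..<r n}" for a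
    using subindex_funcset[OF j] that by auto
  have "A \<inter> level_box n j = (\<Union>a\<in>{..<k} \<rightarrow>\<^sub>E {..<r n}. A \<inter> level_box (Suc n) (subindex n j a))"
    using box_eq_UN[OF j] by blast
  moreover have "measure P \<dots> =
      (\<Sum>a\<in>{..<k} \<rightarrow>\<^sub>E {..<r n}. measure P (A \<inter> level_box (Suc n) (subindex n j a)))"
  proof (rule measure_finite_Union)
    show "finite ({..<k} \<rightarrow>\<^sub>E {..<r n})" by (intro finite_PiE) auto
    show "disjoint_family_on (\<lambda>a. A \<inter> level_box (Suc n) (subindex n j a)) ({..<k} \<rightarrow>\<^sub>E {..<r n})"
      unfolding disjoint_family_on_def
    proof (intro ballI impI)
      fix a c assume ac: "a \<in> {..<k} \<rightarrow>\<^sub>E {..<r n}" "c \<in> {..<k} \<rightarrow>\<^sub>E {..<r n}" "a \<noteq> c"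
      then obtain i where i: "i < k" "a i \<noteq> c i" by (meson PiE_ext lessThan_iff)
      then have "subindex n j a i \<noteq> subindex n j c i"
        using strict_mono_eq[OF strict_mono_offset[of n]] by (simp add: subindex_def)
      then have "level_box (Suc n) (subindex n j a) \<inter> level_box (Suc n) (subindex n j c) = {}"
        using box_disjoint[OF sub[OF ac(1)] sub[OF ac(2)] i(1)] by simp
      then show "A \<inter> level_box (Suc n) (subindex n j a) \<inter> (A \<inter> level_box (Suc n) (subindex n j c)) = {}" by blast
    qed
    show "(\<lambda>a. A \<inter> level_box (Suc n) (subindex n j a)) ` ({..<k} \<rightarrow>\<^sub>E {..<r n}) \<subseteq> sets P"
      using sub A by (auto intro: box_sets)
    show "emeasure P (A \<inter> level_box (Suc n) (subindex n j a)) \<noteq> \<infinity>" if "a \<in> {..<k} \<rightarrow>\<^sub>E {..<r n}" for a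
      by (rule emeasure_Int_box_finite[OF sub[OF that]])
  qed
  ultimately show ?thesis by simp
qed

section \<open>Wandering sets\<close>

context
  fixes A :: "(nat \<Rightarrow> real) set"
  assumes A: "A \<in> sets P" and wandering: "\<And>n. n \<ge> 1 \<Longrightarrow> A \<inter> (S ^^ n) -` A = {}"
begin

text \<open>Pulling the diagonal subboxes of a box back to the leftmost one along the powers of \<open>S\<close>
  turns the traces of \<open>A\<close> into disjoint subsets of that leftmost subbox.\<close>

lemma diagonal_bound:
  assumes j: "j \<in> {..<k} \<rightarrow> {..<height n}"
  shows "(\<Sum>a<r n. measure P (A \<inter> level_box (Suc n) (subindex n j (\<lambda>_. a)))) \<le> width (Suc n) ^ k"
proof -
  define B where "B a = level_box (Suc n) (subindex n j (\<lambda>_. a))" for a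
  define G where "G a = B 0 \<inter> ((S ^^ offset n a) -` A \<inter> space P)" for a
  have r0: "0 < r n" using r_ge_2[of n] by simp
  have sub: "subindex n j (\<lambda>_. a) \<in> {..<k} \<rightarrow> {..<height (Suc n)}" if "a < r n" for a
    using subindex_funcset[OF j, of "\<lambda>_. a"] that by auto
  have Bs: "B a \<in> sets P" if "a < r n" for a unfolding B_def by (rule box_sets[OF sub[OF that]])
  have Gs: "G a \<in> sets P" for a
    unfolding G_def by (intro sets.Int Bs r0 measure_preserving_funpow_sets measure_preserving_S A)
  \<comment> \<open>Along the diagonal every coordinate rises by the same number
    \<open>offset n a\<close> of levels, so one power of \<open>S\<close> relates \<open>B 0\<close>
    to \<open>B a\<close>. Different offsets in different coordinates would need different
    powers.\<close>
  have pre: "(S ^^ offset n a) -` (A \<inter> B a) \<inter> space P = G a" if a: "a < r n" for a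
  proof -
    have "(S ^^ offset n a) x \<in> B a \<longleftrightarrow> x \<in> B 0" if x: "x \<in> space P" for x
    proof -
      have lt: "j i + offset n a < height (Suc n)" if "i < k" for i
        using offset_add_less_height[OF a, of "j i"] j that by (auto simp: add.commute)
      have "(T ^^ offset n a) (x i) \<in> level (Suc n) (offset n a + j i) \<longleftrightarrow> x i \<in> level (Suc n) (j i)"
        if "i < k" for i
        using funpow_in_level_iff[OF lt[OF that], of "x i"] x that
        by (auto simp: space_P PiE_iff add.commute)
      then show ?thesis
        using x by (auto simp: S_funpow B_def level_box_def subindex_def PiE_iff offset_0 space_P)
    qed
    then show ?thesis by (auto simp: G_def)
  qed
  have eq: "measure P (A \<inter> B a) = measure P (G a)" if "a < r n" for a
    using measure_preserving_emeasure[OF measure_preserving_funpow[OF measure_preserving_S], of "A \<inter> B a" "offset n a"]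
      A Bs[OF that] pre[OF that] by (simp add: measure_def)
  \<comment> \<open>A common point would be in \<open>A\<close> after \<open>offset n a\<close>
    steps and again after a positive number of further steps, against the wandering
    assumption.\<close>
  have disj: "G a \<inter> G c = {}" if ac: "a < c" for a c
  proof -
    have d: "offset n c = (offset n c - offset n a) + offset n a" "offset n c - offset n a \<ge> 1"
      using offset_less[OF ac, of n] by auto
    have "(S ^^ offset n c) x = (S ^^ (offset n c - offset n a)) ((S ^^ offset n a) x)" for x
      by (subst d(1)) (simp only: funpow_add comp_apply)
    then show ?thesis using wandering[OF d(2)] by (auto simp: G_def)
  qed
  have "(\<Sum>a<r n. measure P (A \<inter> B a)) = (\<Sum>a<r n. measure P (G a))"
    using eq by (intro sum.cong) auto
  also have "\<dots> = measure P (\<Union>a<r n. G a)"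
  proof (rule measure_finite_Union[symmetric])
    show "disjoint_family_on G {..<r n}"
      unfolding disjoint_family_on_def
    proof (intro ballI impI)
      fix a c :: nat assume "a \<noteq> c"
      then have "a < c \<or> c < a" by linarith
      then show "G a \<inter> G c = {}" using disj[of a c] disj[of c a] by blast
    qed
    show "emeasure P (G a) \<noteq> \<infinity>" for a
      unfolding G_def B_def Int_commute[of "level_box _ _"] by (rule emeasure_Int_box_finite[OF sub[OF r0]])
  qed (use Gs in auto)
  also have "\<dots> \<le> measure P (B 0)"
  proof (rule measure_mono_fmeasurable)
    show "B 0 \<in> fmeasurable P"
      using Bs[OF r0] emeasure_box[OF sub[OF r0]] by (intro fmeasurableI) (auto simp: B_def)
    show "(\<Union>a<r n. G a) \<in> sets P" using Gs by blast
  qed (auto simp: G_def)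
  also have "\<dots> = width (Suc n) ^ k" unfolding B_def by (rule measure_box[OF sub[OF r0]])
  finally show ?thesis by (simp add: B_def)
qed

text \<open>Induction on the number \<open>K\<close> of cutting stages taken into account, with
  column and box arbitrary because the off-diagonal subboxes are boxes of the next column.
  \<open>K = 0\<close> is the trivial bound by the full box.\<close>

lemma box_bound:
  assumes "j \<in> {..<k} \<rightarrow> {..<height n}"
  shows "measure P (A \<inter> level_box n j) \<le>
    width n ^ k * (1 / 2 + 1 / 2 * (\<Prod>m\<in>{n..<n + K}. 1 - 1 / real (r m) ^ (k - 1)))"
  using assms
proof (induction K arbitrary: n j)
  case 0
  have "measure P (A \<inter> level_box n j) \<le> measure P (level_box n j)"
    using A box_sets[OF 0] emeasure_box[OF 0] by (intro measure_mono_fmeasurable fmeasurableI) auto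
  then show ?case by (simp add: measure_box[OF 0])
next
  case (Suc K)
  note j = Suc.prems
  define w where "w = width (Suc n) ^ k"
  define R where "R = real (r n)"
  define q where "q = (\<Prod>m\<in>{Suc n..<Suc n + K}. 1 - 1 / real (r m) ^ (k - 1))"
  define I where "I = ({..<k} \<rightarrow>\<^sub>E {..<r n})"
  define D where "D = (\<lambda>a. \<lambda>i\<in>{..<k}. a) ` {..<r n}"
  define f where "f a = measure P (A \<inter> level_box (Suc n) (subindex n j a))" for a
  have w: "w \<ge> 0" using width_pos[of "Suc n"] by (simp add: w_def)
  have R: "R \<ge> 2" using r_ge_2[of n] by (simp add: R_def)
  have fin: "finite I" unfolding I_def by (intro finite_PiE) auto
  have DI: "D \<subseteq> I" by (auto simp: D_def I_def split: if_splits)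
  have injD: "inj_on (\<lambda>a. \<lambda>i\<in>{..<k}. a) {..<r n}"
  proof (rule inj_onI)
    fix a c assume "(\<lambda>i\<in>{..<k}. a) = (\<lambda>i\<in>{..<k}. c)"
    from fun_cong[OF this, of 0] show "a = c" using k by simp
  qed
  have cardI: "real (card I) = R ^ k" by (simp add: I_def card_PiE R_def)
  have cardD: "card D = r n" unfolding D_def by (simp add: card_image[OF injD])
  have cID: "real (card (I - D)) = R ^ k - R"
    using card_Diff_subset[OF finite_subset[OF DI fin] DI] card_mono[OF fin DI] cardI cardD
    by (simp add: R_def of_nat_diff)
  \<comment> \<open>The members of \<open>D\<close> are constant only on \<open>{..<k}\<close>; a
    box does not depend on the values of its index elsewhere.\<close>
  have "sum f D = (\<Sum>a<r n. measure P (A \<inter> level_box (Suc n) (subindex n j (\<lambda>_. a))))"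
    unfolding D_def sum.reindex[OF injD] comp_def f_def level_box_def subindex_def
    by (intro sum.cong refl arg_cong[where f = "\<lambda>B. measure P (A \<inter> B)"] PiE_cong) simp
  then have fD: "sum f D \<le> w" using diagonal_bound[OF j] by (simp add: w_def)
  have "sum f (I - D) \<le> (\<Sum>a\<in>I - D. w * (1 / 2 + 1 / 2 * q))"
  proof (rule sum_mono)
    fix a assume "a \<in> I - D"
    then have "subindex n j a \<in> {..<k} \<rightarrow> {..<height (Suc n)}"
      using subindex_funcset[OF j, of a] by (auto simp: I_def)
    then show "f a \<le> w * (1 / 2 + 1 / 2 * q)" unfolding f_def w_def q_def by (rule Suc.IH)
  qed
  then have fID: "sum f (I - D) \<le> (R ^ k - R) * (w * (1 / 2 + 1 / 2 * q))" using cID by simp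
  have wn: "width n ^ k = R ^ k * w"
    using R by (simp add: w_def width_Suc R_def[symmetric] power_divide)
  have RR: "R ^ k = R * R ^ (k - 1)" using k by (cases k) auto
  have prod: "(\<Prod>m\<in>{n..<n + Suc K}. 1 - 1 / real (r m) ^ (k - 1)) = (1 - 1 / R ^ (k - 1)) * q"
    unfolding q_def R_def by (simp add: prod.atLeast_Suc_lessThan)
  have "measure P (A \<inter> level_box n j) = sum f I"
    unfolding f_def I_def by (rule measure_Int_box_eq_sum[OF j A])
  also have "\<dots> = sum f (I - D) + sum f D" by (rule sum.subset_diff[OF DI fin])
  also have "\<dots> \<le> (R ^ k - R) * (w * (1 / 2 + 1 / 2 * q)) + w" using fD fID by simp
  \<comment> \<open>The diagonal subboxes have total measure \<open>R * w\<close>, of which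
    \<open>A\<close> occupies at most \<open>w\<close>. By \<open>R \<ge> 2\<close> this is at most
    half, which matches the constant 1/2 in the bound.\<close>
  also have "\<dots> \<le> (R ^ k - R) * (w * (1 / 2 + 1 / 2 * q)) + w * (R / 2)"
    using mult_left_mono[of 1 "R / 2" w] R w by simp
  also have "\<dots> = R ^ k * w * (1 / 2 + 1 / 2 * ((1 - 1 / R ^ (k - 1)) * q))"
    using R unfolding RR by (simp add: field_simps)
  finally show ?case unfolding wn prod .
qed

text \<open>The hypothesis concerns the product from 0 on, while a box of column \<open>n\<close>
  needs the tail from \<open>n\<close>. For \<open>k > 1\<close> the head is positive and can be
  divided out; for \<open>k = 1\<close> every factor is 0 and so is every nonempty tail.\<close>

lemma box_half:
  assumes j: "j \<in> {..<k} \<rightarrow> {..<height n}"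
    and lim: "(\<lambda>N. \<Prod>m<N. 1 - 1 / real (r m) ^ (k - 1)) \<longlonglongrightarrow> 0"
  shows "measure P (A \<inter> level_box n j) \<le> measure P (level_box n j) / 2"
proof -
  let ?c = "\<lambda>m. 1 - 1 / real (r m) ^ (k - 1)"
  have "(\<lambda>K. \<Prod>m\<in>{n..<n + K}. ?c m) \<longlonglongrightarrow> 0"
  proof (cases "k = 1")
    case True
    then have "(\<Prod>m\<in>{n..<n + K}. ?c m) = 0" if "K \<ge> 1" for K using that by auto
    then show ?thesis by (intro tendsto_eventually) (auto simp: eventually_sequentially)
  next
    case False
    have pos: "?c m > 0" for m
    proof -
      have "1 < real (r m) ^ (k - 1)" using r_ge_2[of m] k False by (intro one_less_power) auto
      then show ?thesis by (auto simp: divide_less_eq)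
    qed
    have "(\<Prod>m<n. ?c m) > 0" using pos by (intro prod_pos) auto
    moreover have "(\<Prod>m<n + K. ?c m) = (\<Prod>m<n. ?c m) * (\<Prod>m\<in>{n..<n + K}. ?c m)" for K
      unfolding lessThan_atLeast0 by (rule prod.atLeastLessThan_concat[symmetric]) auto
    moreover have "(\<lambda>K. (\<Prod>m<n + K. ?c m)) \<longlonglongrightarrow> 0"
      using LIMSEQ_ignore_initial_segment[OF lim, of n] by (simp add: add.commute)
    ultimately have "(\<lambda>K. (\<Prod>m<n. ?c m) * (\<Prod>m\<in>{n..<n + K}. ?c m)) \<longlonglongrightarrow> (\<Prod>m<n. ?c m) * 0"
      by simp
    moreover have "(\<Prod>m<n. ?c m) \<noteq> 0" using \<open>(\<Prod>m<n. ?c m) > 0\<close> by (rule less_imp_neq[symmetric])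
    ultimately show ?thesis by (subst (asm) tendsto_mult_left_iff)
  qed
  then have "(\<lambda>K. width n ^ k * (1 / 2 + 1 / 2 * (\<Prod>m\<in>{n..<n + K}. ?c m)))
      \<longlonglongrightarrow> width n ^ k * (1 / 2 + 1 / 2 * 0)"
    by (intro tendsto_intros)
  then have "measure P (A \<inter> level_box n j) \<le> width n ^ k * (1 / 2 + 1 / 2 * 0)"
    by (rule LIMSEQ_le_const) (use box_bound[OF j] in blast)
  then show ?thesis by (simp add: measure_box[OF j])
qed

end

end

context rank_one
begin

lemma level_refine:
  assumes "N \<le> n" and i: "i < height N" "x \<in> level N i" and l: "l < height n" "x \<in> level n l"
  shows "level n l \<subseteq> level N i"
  using assms(1) l
proof (induction arbitrary: l rule: dec_induct)
  case base
  then show ?case using level_unique[of x N l i] i by simp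
next
  case (step n)
  have "x \<in> col_union (col n)"
    using col_union_mono[OF step.hyps(1)] level_subset_col_union[OF i(1)] i(2) by blast
  then obtain q where q: "q < height n" "x \<in> level n q" by (rule col_unionE)
  then obtain a where a: "a < r n" "x \<in> level (Suc n) (offset n a + q)" using level_Suc_ex by blast
  have "l = offset n a + q"
    by (rule level_unique[OF step.prems(2) a(2) step.prems(1) offset_add_less_height[OF a(1) q(1)]])
  then have "level (Suc n) l \<subseteq> level n q" using level_Suc_subset[OF a(1) q(1)] by simp
  then show ?case using step.IH[OF q] by blast
qed

end

context rank_one_product
begin

section \<open>Approximation by unions of boxes\<close>

text \<open>The full product may have infinite measure; these sets have finite measure, as the
  approximation argument requires, and exhaust the space.\<close>

definition stage :: "nat \<Rightarrow> (nat \<Rightarrow> real) set" where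
  "stage N = ({..<k} \<rightarrow>\<^sub>E col_union (col N))"

lemma stage_sets: "stage N \<in> sets P"
  unfolding stage_def using col_union_subset_space by (intro sets_PiM_I_finite) (auto simp: sets_M)

lemma emeasure_stage_finite: "emeasure P (stage N) < \<infinity>"
proof -
  have "emeasure P (stage N) = (\<Prod>i<k. emeasure M (col_union (col N)))"
    unfolding stage_def using col_union_subset_space
    by (intro product_sigma_finite.emeasure_PiM[OF product_sigma_finite_M]) (auto simp: sets_M)
  also have "\<dots> < \<infinity>"
    using emeasure_col_union_finite[of N] by (simp add: ennreal_prod_eq_top power_less_top_ennreal)
  finally show ?thesis .
qed

text \<open>For \<open>N \<le> n\<close> and \<open>E\<close> inside \<open>stage N\<close>, this
  says that \<open>E\<close> is a union of boxes of column \<open>n\<close>. It is phrased as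
  invariance under the relation of sharing a level in every coordinate, so that complements and
  unions are immediate.\<close>

definition saturated :: "nat \<Rightarrow> nat \<Rightarrow> (nat \<Rightarrow> real) set \<Rightarrow> bool" where
  "saturated N n E \<longleftrightarrow> (\<forall>x\<in>E. \<forall>y\<in>stage N.
     (\<forall>i<k. \<exists>l<height n. x i \<in> level n l \<and> y i \<in> level n l) \<longrightarrow> y \<in> E)"

definition box_algebra :: "nat \<Rightarrow> (nat \<Rightarrow> real) set set" where
  "box_algebra N = {E. E \<subseteq> stage N \<and> (\<exists>n\<ge>N. saturated N n E)}"

text \<open>A later column gives a finer relation. This brings two sets of the algebra to a common
  column before their union is taken.\<close>

lemma saturated_mono:
  assumes "saturated N n E" "E \<subseteq> stage N" "N \<le> n" "n \<le> m"
  shows "saturated N m E"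
  unfolding saturated_def
proof (intro ballI impI)
  fix x y assume x: "x \<in> E" and y: "y \<in> stage N"
    and eq: "\<forall>i<k. \<exists>l<height m. x i \<in> level m l \<and> y i \<in> level m l"
  have "\<exists>l<height n. x i \<in> level n l \<and> y i \<in> level n l" if i: "i < k" for i
  proof -
    have "x i \<in> col_union (col n)"
      using x assms(2) i col_union_mono[OF assms(3)] by (auto simp: stage_def PiE_iff)
    then obtain q where q: "q < height n" "x i \<in> level n q" by (rule col_unionE)
    obtain l where l: "l < height m" "x i \<in> level m l" "y i \<in> level m l" using eq i by blast
    then have "level m l \<subseteq> level n q" using level_refine[OF assms(4) q] by blast
    then show ?thesis using q l by blast
  qed
  then show "y \<in> E" using assms(1) x y unfolding saturated_def by blast
qed

lemma saturated_eq_UN_boxes: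
  assumes E: "saturated N n E" "E \<subseteq> stage N" "N \<le> n"
  shows "E = (\<Union>j\<in>{j \<in> indices n. level_box n j \<subseteq> E}. level_box n j)"
proof
  show "E \<subseteq> (\<Union>j\<in>{j \<in> indices n. level_box n j \<subseteq> E}. level_box n j)"
  proof
    fix x assume x: "x \<in> E"
    have xc: "x i \<in> col_union (col N)" if "i < k" for i
      using x E(2) that by (auto simp: stage_def PiE_iff)
    have "\<forall>i\<in>{..<k}. \<exists>l<height n. x i \<in> level n l"
    proof
      fix i assume "i \<in> {..<k}"
      then have "x i \<in> col_union (col n)" using xc col_union_mono[OF E(3)] by blast
      then show "\<exists>l<height n. x i \<in> level n l" by (rule col_unionE) blast
    qed
    then obtain f where f: "\<forall>i\<in>{..<k}. f i < height n \<and> x i \<in> level n (f i)" by metis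
    define j where "j = restrict f {..<k}"
    have j: "j \<in> indices n" using f by (auto simp: j_def indices_def)
    have jx: "j i < height n" "x i \<in> level n (j i)" if "i < k" for i using f that by (auto simp: j_def)
    have "x \<in> level_box n j" using jx x E(2) by (auto simp: level_box_def stage_def PiE_iff)
    \<comment> \<open>One point suffices: since \<open>N \<le> n\<close>, each level of column
      \<open>n\<close> that meets \<open>col_union (col N)\<close> lies inside a level of column
      \<open>N\<close>. So the whole box stays in the stage, and saturation puts it into
      \<open>E\<close>.\<close>
    moreover have "level_box n j \<subseteq> E"
    proof
      fix y assume y: "y \<in> level_box n j"
      have "y i \<in> col_union (col N)" if i: "i < k" for i
      proof -
        obtain q where q: "q < height N" "x i \<in> level N q" using xc[OF i] by (rule col_unionE)
        have "level n (j i) \<subseteq> level N q" by (rule level_refine[OF E(3) q jx[OF i]])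
        moreover have "y i \<in> level n (j i)" using y i by (auto simp: level_box_def PiE_iff)
        ultimately show ?thesis using level_subset_col_union[OF q(1)] by blast
      qed
      then have "y \<in> stage N" using y by (auto simp: stage_def level_box_def PiE_iff)
      moreover have "\<exists>l<height n. x i \<in> level n l \<and> y i \<in> level n l" if "i < k" for i
        using jx[OF that] y that by (auto simp: level_box_def PiE_iff)
      ultimately show "y \<in> E" using E(1) x unfolding saturated_def by blast
    qed
    ultimately show "x \<in> (\<Union>j\<in>{j \<in> indices n. level_box n j \<subseteq> E}. level_box n j)" using j by blast
  qed
qed auto

lemma finite_indices: "finite (indices n)"
  unfolding indices_def by (intro finite_PiE) auto

lemma indices_funcset: "j \<in> indices n \<Longrightarrow> j \<in> {..<k} \<rightarrow> {..<height n}"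
  by (auto simp: indices_def)

lemma measure_Int_boxes:
  assumes J: "J \<subseteq> indices n" and A: "A \<in> sets P"
  shows "measure P (A \<inter> (\<Union>j\<in>J. level_box n j)) = (\<Sum>j\<in>J. measure P (A \<inter> level_box n j))"
proof -
  have "measure P (\<Union>j\<in>J. A \<inter> level_box n j) = (\<Sum>j\<in>J. measure P (A \<inter> level_box n j))"
  proof (rule measure_finite_Union)
    show "finite J" using J finite_indices by (rule finite_subset)
    show "(\<lambda>j. A \<inter> level_box n j) ` J \<subseteq> sets P"
      using J by (intro image_subsetI sets.Int A box_sets indices_funcset) auto
    show "emeasure P (A \<inter> level_box n j) \<noteq> \<infinity>" if "j \<in> J" for j
      using J that by (intro emeasure_Int_box_finite indices_funcset) auto
    show "disjoint_family_on (\<lambda>j. A \<inter> level_box n j) J"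
      unfolding disjoint_family_on_def
    proof (intro ballI impI)
      fix j j' assume jj: "j \<in> J" "j' \<in> J" "j \<noteq> j'"
      then have "j \<in> indices n" "j' \<in> indices n" using J by auto
      then obtain i where "i < k" "j i \<noteq> j' i" using jj(3) unfolding indices_def
        by (meson PiE_ext lessThan_iff)
      then have "level_box n j \<inter> level_box n j' = {}"
        using box_disjoint[of j n j' i] indices_funcset \<open>j \<in> indices n\<close> \<open>j' \<in> indices n\<close> by blast
      then show "(A \<inter> level_box n j) \<inter> (A \<inter> level_box n j') = {}" by blast
    qed
  qed
  then show ?thesis by (simp only: Int_UN_distrib)
qed

lemma box_algebra_sets:
  assumes "E \<in> box_algebra N"
  shows "E \<in> sets P"
proof -
  obtain n where n: "E \<subseteq> stage N" "N \<le> n" "saturated N n E"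
    using assms by (auto simp: box_algebra_def)
  have "(\<Union>j\<in>{j \<in> indices n. level_box n j \<subseteq> E}. level_box n j) \<in> sets P"
    using finite_indices[of n] by (intro sets.finite_UN) (auto intro!: box_sets indices_funcset)
  then show ?thesis using saturated_eq_UN_boxes[OF n(3,1,2)] by simp
qed

lemma algebra_box_algebra: "algebra (stage N) (box_algebra N)"
  unfolding algebra_iff_Un
proof (intro conjI ballI)
  show "box_algebra N \<subseteq> Pow (stage N)" by (auto simp: box_algebra_def)
  show "{} \<in> box_algebra N" by (auto simp: box_algebra_def saturated_def)
next
  fix E assume "E \<in> box_algebra N"
  then obtain n where n: "E \<subseteq> stage N" "N \<le> n" "saturated N n E" by (auto simp: box_algebra_def)
  then have "saturated N n (stage N - E)" unfolding saturated_def by blast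
  then show "stage N - E \<in> box_algebra N" using n by (auto simp: box_algebra_def)
next
  fix E F assume "E \<in> box_algebra N" "F \<in> box_algebra N"
  then obtain n m where n: "E \<subseteq> stage N" "N \<le> n" "saturated N n E"
    and m: "F \<subseteq> stage N" "N \<le> m" "saturated N m F" by (auto simp: box_algebra_def)
  have "saturated N (max n m) E" "saturated N (max n m) F"
    using saturated_mono[OF n(3,1,2)] saturated_mono[OF m(3,1,2)] by auto
  then have "saturated N (max n m) (E \<union> F)" unfolding saturated_def by blast
  moreover have "N \<le> max n m" using n by simp
  ultimately show "E \<union> F \<in> box_algebra N" using n m unfolding box_algebra_def by blast
qed

lemma cylinder_box_algebra:
  assumes "N \<le> n" "i < k" "l < height n"
  shows "{x \<in> stage N. x i \<in> level n l} \<in> box_algebra N"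
proof -
  have "saturated N n {x \<in> stage N. x i \<in> level n l}"
    unfolding saturated_def
  proof (intro ballI impI)
    fix x y assume x: "x \<in> {x \<in> stage N. x i \<in> level n l}" and y: "y \<in> stage N"
      and eq: "\<forall>i<k. \<exists>l<height n. x i \<in> level n l \<and> y i \<in> level n l"
    obtain l' where l': "l' < height n" "x i \<in> level n l'" "y i \<in> level n l'" using eq assms by blast
    then have "l' = l" using level_unique[of "x i" n l' l] x assms by simp
    then show "y \<in> {x \<in> stage N. x i \<in> level n l}" using y l' by simp
  qed
  then show ?thesis using assms by (auto simp: box_algebra_def)
qed

text \<open>Level widths tend to 0, so a level around a point of an open set eventually fits inside
  it. With the cylinders this generates the Borel part of the product sigma-algebra.\<close>

lemma stage_open_eq_UN:
  assumes "open U" "i < k"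
  shows "{x \<in> stage N. x i \<in> U} =
    (\<Union>n\<in>{N..}. \<Union>l\<in>{l. l < height n \<and> level n l \<subseteq> U}. {x \<in> stage N. x i \<in> level n l})"
proof
  show "{x \<in> stage N. x i \<in> U} \<subseteq>
    (\<Union>n\<in>{N..}. \<Union>l\<in>{l. l < height n \<and> level n l \<subseteq> U}. {x \<in> stage N. x i \<in> level n l})"
  proof clarify
    fix x assume x: "x \<in> stage N" "x i \<in> U"
    obtain e where e: "e > 0" "\<And>y. dist y (x i) < e \<Longrightarrow> y \<in> U"
      using assms(1) x(2) unfolding open_dist by blast
    obtain n where n: "n \<ge> N" "width n < e" using width_less[OF e(1)] by blast
    have "x i \<in> col_union (col n)"
      using x(1) assms(2) col_union_mono[OF n(1)] by (auto simp: stage_def PiE_iff)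
    then obtain l where l: "l < height n" "x i \<in> level n l" by (rule col_unionE)
    have "level n l \<subseteq> U"
    proof
      fix y assume "y \<in> level n l"
      then have "dist y (x i) < width n" using l(2) by (auto simp: col_level_def dist_real_def)
      then show "y \<in> U" using e(2) n(2) by simp
    qed
    then show "x \<in> (\<Union>n\<in>{N..}. \<Union>l\<in>{l. l < height n \<and> level n l \<subseteq> U}. {x \<in> stage N. x i \<in> level n l})"
      using n(1) l x(1) by blast
  qed
qed auto

text \<open>The cylinder is a rectangle with one null factor. It accounts for the Lebesgue sets that
  are not Borel.\<close>

lemma null_cylinder:
  assumes "Z \<in> null_sets lebesgue" "i < k"
  shows "{x \<in> stage N. x i \<in> Z} \<in> null_sets P"
proof -
  define F where "F i' = (if i' = i then Z \<inter> col_union (col N) else col_union (col N))" for i'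
  have Z0: "Z \<inter> col_union (col N) \<in> null_sets lebesgue"
    using assms(1) by (intro null_set_Int2) auto
  have F: "F i' \<in> sets M" for i'
    using col_union_subset_space[of N] assms(1) by (auto simp: F_def sets_M)
  have "emeasure M (F i) = 0"
    using Z0 col_union_subset_space[of N] by (subst emeasure_M) (auto simp: F_def)
  have "{x \<in> stage N. x i \<in> Z} = Pi\<^sub>E {..<k} F"
  proof (rule set_eqI)
    fix x
    have "(\<forall>i'<k. x i' \<in> F i') \<longleftrightarrow> (\<forall>i'<k. x i' \<in> col_union (col N)) \<and> x i \<in> Z"
      using assms(2) unfolding F_def by (metis Int_iff)
    then show "x \<in> {x \<in> stage N. x i \<in> Z} \<longleftrightarrow> x \<in> Pi\<^sub>E {..<k} F"
      by (auto simp: stage_def PiE_iff Ball_def)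
  qed
  moreover have "Pi\<^sub>E {..<k} F \<in> sets P" using F by (intro sets_PiM_I_finite) auto
  moreover have "emeasure P (Pi\<^sub>E {..<k} F) = (\<Prod>i<k. emeasure M (F i))"
    using F by (intro product_sigma_finite.emeasure_PiM[OF product_sigma_finite_M]) auto
  moreover have "\<dots> = 0" using \<open>emeasure M (F i) = 0\<close> assms(2) by (intro prod_zero) auto
  ultimately show ?thesis by (simp add: null_sets_def)
qed

text \<open>The approximable subsets of the stage form a sigma-algebra that makes all coordinates
  measurable into \<open>M\<close>. Hence the inclusion into the product is measurable, which is the
  claim for every set of \<open>P\<close>.\<close>

lemma box_approximation:
  assumes A: "A \<in> sets P" and e: "e > 0"
  shows "\<exists>E\<in>box_algebra N. measure P (sym_diff (A \<inter> stage N) E) < e"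
proof -
  define Q where "Q = restrict_space P (stage N)"
  have st: "stage N \<inter> space P \<in> sets P" using stage_sets by auto
  have st': "stage N \<subseteq> space P" by (rule sets.sets_into_space[OF stage_sets])
  have spQ: "space Q = stage N" using st' by (auto simp: Q_def space_restrict_space)
  have sQ: "E \<in> sets Q \<longleftrightarrow> E \<in> sets P \<and> E \<subseteq> stage N" for E
    unfolding Q_def by (subst sets_restrict_space_iff[OF st]) auto
  have mQ: "measure Q E = measure P E" if "E \<subseteq> stage N" for E
    unfolding Q_def by (rule measure_restrict_space[OF st that])
  interpret Q: finite_measure Q
  proof
    show "emeasure Q (space Q) \<noteq> \<infinity>"
      using emeasure_restrict_space[OF st, of "stage N"] emeasure_stage_finite[of N]
      unfolding spQ by (simp add: Q_def)
  qed
  define \<D> where "\<D> = {E \<in> sets Q. \<forall>e>0. \<exists>B\<in>box_algebra N. measure Q (sym_diff E B) < e}"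
  have sub: "box_algebra N \<subseteq> sets Q" 
  proof
    fix E assume E: "E \<in> box_algebra N"
    then have "E \<subseteq> stage N" by (simp add: box_algebra_def)
    then show "E \<in> sets Q" using box_algebra_sets[OF E] by (simp add: sQ)
  qed
  have sa: "sigma_algebra (stage N) \<D>"
    using Q.sigma_algebra_approx[of "box_algebra N"] algebra_box_algebra sub
    unfolding spQ \<D>_def by blast
  have boxD: "E \<in> \<D>" if "E \<in> box_algebra N" for E
    using that sub unfolding \<D>_def by (auto intro!: bexI[of _ E])
  \<comment> \<open>Null sets are approximated by the empty set, with error zero.\<close>
  have nullD: "E \<in> \<D>" if "E \<in> null_sets P" "E \<subseteq> stage N" for E
  proof -
    have "measure Q E = 0" using that mQ[OF that(2)] by (auto simp: measure_def null_sets_def)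
    moreover have "{} \<in> box_algebra N" by (auto simp: box_algebra_def saturated_def)
    ultimately show ?thesis using that by (auto simp: \<D>_def sQ intro!: bexI[of _ "{}"])
  qed
  \<comment> \<open>Only the sigma-algebra matters; the zero measure is a placeholder that makes
    measurability of maps expressible.\<close>
  define D where "D = measure_of (stage N) \<D> (\<lambda>_. 0)"
  have setsD: "sets D = \<D>" and spD: "space D = stage N"
    using sigma_algebra.sets_measure_of_eq[OF sa] sigma_algebra.space_measure_of_eq[OF sa]
    by (auto simp: D_def)
  have comp: "(\<lambda>x. x i) \<in> measurable D M" if i: "i < k" for i
  proof -
    have "(\<lambda>x. x i) \<in> measurable D borel"
    proof (rule borel_measurableI)
      fix U :: "real set" assume "open U"
      have "{x \<in> stage N. x i \<in> U} \<in> sets D"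
        unfolding stage_open_eq_UN[OF \<open>open U\<close> i]
      proof (intro sets.countable_UN'')
        show "{x \<in> stage N. x i \<in> level n l} \<in> sets D"
          if "n \<in> {N..}" "l \<in> {l. l < height n \<and> level n l \<subseteq> U}" for n l
          unfolding setsD using that i by (intro boxD cylinder_box_algebra) auto
      qed auto
      moreover have "(\<lambda>x. x i) -` U \<inter> space D = {x \<in> stage N. x i \<in> U}" by (auto simp: spD)
      ultimately show "(\<lambda>x. x i) -` U \<inter> space D \<in> sets D" by simp
    qed
    then have "(\<lambda>x. x i) -` B \<inter> space D \<in> sets D" if "B \<in> sets borel" for B
      using that by (rule measurable_sets)
    moreover have "(\<lambda>x. x i) -` B \<inter> space D = {x \<in> stage N. x i \<in> B}" for B
      by (auto simp: spD)
    ultimately have bor: "{x \<in> stage N. x i \<in> B} \<in> sets D" if "B \<in> sets borel" for B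
      using that by simp
    show ?thesis
    proof (rule measurableI)
      fix x assume "x \<in> space D"
      then show "x i \<in> space M"
        using i col_union_subset_space[of N] by (auto simp: spD stage_def space_M PiE_iff)
    next
      fix B assume "B \<in> sets M"
      then have "B \<in> sets lebesgue" by (simp add: sets_M)
      then obtain B' Z Z' where Z: "B = B' \<union> Z" "Z \<subseteq> Z'" "Z' \<in> null_sets lborel" "B' \<in> sets lborel"
        by (rule sets_completionE)
      then have "Z \<in> null_sets lebesgue" by (metis null_sets_completion_subset null_sets_completionI)
      then have "{x \<in> stage N. x i \<in> Z} \<in> sets D"
        unfolding setsD using i by (intro nullD null_cylinder) auto
      moreover have "{x \<in> stage N. x i \<in> B'} \<in> sets D" using Z(4) by (intro bor) simp
      moreover have "(\<lambda>x. x i) -` B \<inter> space D = {x \<in> stage N. x i \<in> B'} \<union> {x \<in> stage N. x i \<in> Z}"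
        by (auto simp: Z(1) spD)
      ultimately show "(\<lambda>x. x i) -` B \<inter> space D \<in> sets D" by simp
    qed
  qed
  have "(\<lambda>x i. x i) \<in> measurable D P"
    using comp st' by (intro measurable_PiM_single') (auto simp: spD space_PiM)
  then have "(\<lambda>x i. x i) -` A \<inter> space D \<in> sets D" using A by (rule measurable_sets)
  then have "A \<inter> stage N \<in> \<D>" by (simp add: spD setsD)
  then obtain B where B: "B \<in> box_algebra N" "measure Q (sym_diff (A \<inter> stage N) B) < e"
    using e unfolding \<D>_def by blast
  moreover have "sym_diff (A \<inter> stage N) B \<subseteq> stage N" using B(1) by (auto simp: box_algebra_def)
  ultimately show ?thesis using mQ by auto
qed

lemma space_P_eq_UN_stage: "space P = (\<Union>N. stage N)"
proof
  show "space P \<subseteq> (\<Union>N. stage N)"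
  proof
    fix x assume x: "x \<in> space P"
    have "\<forall>i\<in>{..<k}. \<exists>N. x i \<in> col_union (col N)"
      using x by (auto simp: space_P rank_one_space_def PiE_iff)
    then obtain f where f: "\<forall>i\<in>{..<k}. x i \<in> col_union (col (f i))" by metis
    define N where "N = (\<Sum>i<k. f i)"
    have "x i \<in> col_union (col N)" if "i < k" for i
    proof -
      have "f i \<le> N" unfolding N_def using that by (intro member_le_sum) auto
      then show ?thesis using f that col_union_mono by blast
    qed
    then have "x \<in> stage N" using x by (auto simp: space_P stage_def PiE_iff)
    then show "x \<in> (\<Union>N. stage N)" by blast
  qed
  show "(\<Union>N. stage N) \<subseteq> space P" using sets.sets_into_space[OF stage_sets] by blast
qed

lemma wandering_null:
  assumes A: "A \<in> sets P" and wandering: "\<And>n. n \<ge> 1 \<Longrightarrow> A \<inter> (S ^^ n) -` A = {}"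
    and lim: "(\<lambda>N. \<Prod>m<N. 1 - 1 / real (r m) ^ (k - 1)) \<longlonglongrightarrow> 0"
  shows "emeasure P A = 0"
proof -
  have "A \<inter> stage N \<in> null_sets P" for N
  proof -
    have fm: "stage N \<in> fmeasurable P"
      using stage_sets emeasure_stage_finite by (intro fmeasurableI)
    have fmI: "F \<in> fmeasurable P" if "F \<in> sets P" "F \<subseteq> stage N" for F
      by (rule fmeasurableI2[OF fm that(2,1)])
    have AS: "A \<inter> stage N \<in> fmeasurable P" using A stage_sets by (intro fmI) auto
    have "measure P (A \<inter> stage N) \<le> 0 + e" if e: "e > 0" for e
    proof -
      \<comment> \<open>With a the measure of \<open>A \<inter> stage N\<close>, the two estimates
        below give a <= (a + e/3)/2 + e/3, that is a <= e.\<close>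
      have "e / 3 > 0" using e by simp
      then obtain E where E: "E \<in> box_algebra N" "measure P (sym_diff (A \<inter> stage N) E) < e / 3"
        using box_approximation[OF A] by blast
      obtain n where n: "E \<subseteq> stage N" "N \<le> n" "saturated N n E"
        using E(1) by (auto simp: box_algebra_def)
      define J where "J = {j \<in> indices n. level_box n j \<subseteq> E}"
      have J: "J \<subseteq> indices n" by (auto simp: J_def)
      have EJ: "E = (\<Union>j\<in>J. level_box n j)" unfolding J_def by (rule saturated_eq_UN_boxes[OF n(3,1,2)])
      have Ef: "E \<in> fmeasurable P" using box_algebra_sets[OF E(1)] n(1) by (rule fmI)
      have sd: "sym_diff (A \<inter> stage N) E \<in> fmeasurable P"
        using Ef AS by (intro fmeasurable.Un fmeasurable.Diff) auto
      have AE: "A \<inter> E \<in> fmeasurable P" using Ef A by (intro fmI) (use n in auto)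
      have "measure P (A \<inter> E) = (\<Sum>j\<in>J. measure P (A \<inter> level_box n j))"
        unfolding EJ by (rule measure_Int_boxes[OF J A])
      also have "\<dots> \<le> (\<Sum>j\<in>J. measure P (level_box n j) / 2)"
        using J by (intro sum_mono box_half[OF A wandering _ lim] indices_funcset) auto
      \<comment> \<open>Inserting \<open>space P\<close> allows the additivity lemma for traces on
        boxes to be used for the boxes themselves.\<close>
      also have "\<dots> = (\<Sum>j\<in>J. measure P (space P \<inter> level_box n j)) / 2"
      proof -
        have "space P \<inter> level_box n j = level_box n j" if "j \<in> J" for j
          using box_subset_space[OF indices_funcset] J that by blast
        then show ?thesis by (simp add: sum_divide_distrib)
      qed
      also have "\<dots> = measure P (space P \<inter> E) / 2"
        unfolding EJ by (simp add: measure_Int_boxes[OF J sets.top])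
      also have "space P \<inter> E = E" using sets.sets_into_space[OF box_algebra_sets[OF E(1)]] by blast
      finally have half: "measure P (A \<inter> E) \<le> measure P E / 2" .
      have "measure P (A \<inter> stage N) \<le> measure P (A \<inter> E \<union> sym_diff (A \<inter> stage N) E)"
        using AE sd AS by (intro measure_mono_fmeasurable) auto
      also have "\<dots> \<le> measure P (A \<inter> E) + measure P (sym_diff (A \<inter> stage N) E)"
        using AE sd by (intro measure_Un_le) auto
      finally have 1: "measure P (A \<inter> stage N) \<le> measure P E / 2 + e / 3" using half E(2) by simp
      have "measure P E \<le> measure P (A \<inter> stage N \<union> sym_diff (A \<inter> stage N) E)"
        using Ef sd AS by (intro measure_mono_fmeasurable) auto
      also have "\<dots> \<le> measure P (A \<inter> stage N) + measure P (sym_diff (A \<inter> stage N) E)"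
        using AS sd by (intro measure_Un_le) auto
      finally show ?thesis using 1 E(2) by simp
    qed
    then have "measure P (A \<inter> stage N) \<le> 0" by (rule field_le_epsilon)
    then have "measure P (A \<inter> stage N) = 0" by (simp add: measure_le_0_iff)
    then show ?thesis
      using AS emeasure_eq_measure2[OF AS] by (auto simp: null_sets_def)
  qed
  then have "(\<Union>N. A \<inter> stage N) \<in> null_sets P" by (intro null_sets_UN) auto
  moreover have "(\<Union>N. A \<inter> stage N) = A"
    using sets.sets_into_space[OF A] space_P_eq_UN_stage by blast
  ultimately show ?thesis by (simp add: null_sets_def)
qed

section \<open>Conservativity of all integer powers\<close>

lemma conservative_S:
  assumes "(\<lambda>N. \<Prod>m<N. 1 - 1 / real (r m) ^ (k - 1)) \<longlonglongrightarrow> 0"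
  shows "conservative P S"
  by (rule conservativeI_wandering[OF measure_preserving_S]) (rule wandering_null[OF _ _ assms])

lemma conservative_inverse:
  assumes "conservative P S"
  shows "conservative P (product_map k (inverse_map X T))"
proof (rule conservative_left_inverse[OF assms])
  show "product_map k (inverse_map X T) \<in> measurable P P"
    by (rule measurable_product_map[OF measurable_inverse_map])
  have inv: "inverse_map X T (T y) = y" if "y \<in> X" for y
    using that inj_on_map by (simp add: inverse_map_def)
  fix x assume "x \<in> space P"
  then show "product_map k (inverse_map X T) (S x) = x"
    by (auto simp: product_map_def space_P PiE_iff extensional_def fun_eq_iff inv)
qed

lemma conservative_int_power:
  assumes "conservative P S"
  shows "conservative P (product_map k (int_power X T l))"
proof -
  have pow: "conservative P (product_map k (R ^^ n))" if "conservative P (product_map k R)" for R n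
    by (rule conservative_cong[OF _ conservative_funpow[OF that]])
      (rule product_map_funpow, simp add: space_P PiE_def)
  show ?thesis
    using pow[OF assms] pow[OF conservative_inverse[OF assms]] by (simp add: int_power_def)
qed

end

theorem theorem3p2:
  fixes r :: "nat \<Rightarrow> nat" and s :: "nat \<Rightarrow> nat \<Rightarrow> nat" and p :: "nat \<Rightarrow> nat \<Rightarrow> nat \<Rightarrow> real"
    and k :: nat
  assumes "rank_one_data r s p"
    and "emeasure lebesgue (rank_one_space r s p) = \<infinity>"
    and "k \<ge> 1"
    and "(\<lambda>N. \<Prod>n<N. 1 - 1 / real (card (height_set r s p n)) ^ (k - 1)) \<longlonglongrightarrow> 0"
  shows "\<forall>l::int. conservative (Pi\<^sub>M {..<k} (\<lambda>_. rank_one_measure r s p))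
           (product_map k (int_power (rank_one_space r s p) (rank_one_map r s p) l))"
proof -
  interpret rank_one_product r s p k
    using assms by unfold_locales
  have "(\<lambda>N. \<Prod>n<N. 1 - 1 / real (r n) ^ (k - 1)) \<longlonglongrightarrow> 0"
    using assms(4) by (simp only: card_height_set[OF assms(1)])
  then show ?thesis using conservative_int_power[OF conservative_S] by blast
qed

end
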